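(* Let $R=\mathbb{Z}[I]$ be a fusion algebra with (at most countable) basis $I$, unit $e\in I$ and dimension function $d$. Then the following are equivalent: (A) The fusion algebra $R$ is amenable, i.e. $1$ belongs to the spectrum of $\lambda_{2,\mu}\in B(\ell^2(I,\sigma))$ for every finitely supported, symmetric probability measure $\mu$ on $I$. (FC1) For every finitely supported, symmetric probability measure $\mu$ on $I$ with $e\in \operatorname{supp}(\mu)$ and every $\varepsilon>0$ there exists a finite subset $F\subseteq I$ such that $$\sum_{\xi\in \operatorname{supp}(\chi_F\ast \mu)}d(\xi)^2<(1+\varepsilon)\sum_{\xi\in F}d(\xi)^2.$$ (FC2) For every finite, non-empty subset $S\subseteq I$ and every $\varepsilon>0$ there exists a finite subset $F\subseteq I$ such that $$\|\rho_{1,\xi}(\chi_F)-\chi_F\|_{1,\sigma}<\varepsilon \|\chi_F\|_{1,\sigma}\quad\text{for all }\xi\in S.$$ (FC3) For every finite, non-empty subset $S\subseteq I$ and every $\varepsilon>0$ there exists a finite subset $F\subseteq I$ such that $$\sum_{\xi\in \partial_S(F)}d(\xi)^2<\varepsilon\sum_{\xi\in F}d(\xi)^2.$$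
   Context: Fusion algebra: a unital ring $R$ which is free as a $\mathbb{Z}$-module with a distinguished basis $I$ containing the unit $e$, such that: (i) for all $\xi,\eta\in I$ the integers $N_{\xi,\eta}^\alpha$ defined by $\xi\eta=\sum_{\alpha\in I}N_{\xi,\eta}^\alpha\alpha$ are non-negative; (ii) $R$ has a $\mathbb{Z}$-linear, anti-multiplicative involution $x\mapsto\bar x$ mapping $I$ onto itself; (iii) Frobenius reciprocity: $N_{\xi,\eta}^\alpha=N_{\bar\xi,\alpha}^\eta=N_{\alpha,\bar\eta}^\xi$ for $\xi,\eta,\alpha\in I$; (iv) there is a $\mathbb{Z}$-linear multiplicative function $d\colon R\to\mathbb{R}$ (the dimension function, part of the data) with $d(\xi)\in[1,\infty)$ and $d(\xi)=d(\bar\xi)$ for all $\xi\in I$. All fusion algebras are assumed to have an at most countable basis. For $r=\sum_\alpha k_\alpha\alpha\in R$, $\operatorname{supp}(r)=\{\alpha\in I\mid k_\alpha\neq 0\}$. Convolution: for $\xi,\eta\in I$ the weighted convolution of Dirac measures is $\delta_\xi\ast\delta_\eta=\sum_{\alpha\in I}\frac{d(\alpha)}{d(\xi)d(\eta)}N_{\xi,\eta}^\alpha\delta_\alpha\in\ell^1(I)$, extended linearly and continuously to $\ell^1(I)$. $\chi_F$ is the characteristic function of $F$; the support of a function on $I$ is the set where it is non-zero. A measure $\mu$ on $I$ is symmetric if $\mu(\bar\xi)=\mu(\xi)$ for all $\xi\in I$. Operators: $\sigma$ is the measure on $I$ with $\sigma(\xi)=d(\xi)^2$; $\|\cdot\|_{p,\sigma}$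 is the norm of $\ell^p(I,\sigma)$. For $f\in\ell^\infty(I)$ and $\xi\in I$ put $$\lambda_\xi(f)(\eta)=\sum_{\alpha\in I}f(\alpha)(\delta_{\bar\xi}\ast\delta_\eta)(\alpha),\qquad \rho_\xi(f)(\eta)=\sum_{\alpha\in I}f(\alpha)(\delta_\eta\ast\delta_\xi)(\alpha).$$ These restrict to bounded operators $\lambda_{p,\xi},\rho_{p,\xi}$ on $\ell^p(I,\sigma)$ for $p\in\mathbb{N}\cup\{\infty\}$. For a finitely supported measure $\mu$, $\lambda_{p,\mu}=\sum_{\xi}\mu(\xi)\lambda_{p,\xi}$. Boundary: for finite subsets $S,F\subseteq I$, with $F^c=I\setminus F$, $$\partial_S(F)=\{\alpha\in F\mid\exists\,\xi\in S:\operatorname{supp}(\alpha\xi)\nsubseteq F\}\cup\{\alpha\in F^c\mid\exists\,\xi\in S:\operatorname{supp}(\alpha\xi)\nsubseteq F^c\}.$$ *)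

theory Defs
  imports "HOL-Probability.Probability"
begin

text \<open>
  Every ring is a module over the integers; the locale \<open>module\<close> then provides independence,
  span and coordinates (\<open>representation\<close>) with respect to a \<open>\<int>\<close>-basis.
\<close>

abbreviation int_scale :: "int \<Rightarrow> 'r::ring_1 \<Rightarrow> 'r"
  where "int_scale \<equiv> (\<lambda>k x. of_int k * x)"

interpretation int_module: module "int_scale :: int \<Rightarrow> 'r::ring_1 \<Rightarrow> 'r"
  by unfold_locales (simp_all add: algebra_simps)

definition fusion_coeff :: "'r::ring_1 set \<Rightarrow> 'r \<Rightarrow> 'r \<Rightarrow> 'r \<Rightarrow> int"
  where "fusion_coeff I \<xi> \<eta> \<alpha> = int_module.representation I (\<xi> * \<eta>) \<alpha>"

definition basis_supp :: "'r::ring_1 set \<Rightarrow> 'r \<Rightarrow> 'r set"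
  where "basis_supp I r = {\<alpha> \<in> I. int_module.representation I r \<alpha> \<noteq> 0}"

locale fusion_algebra =
  fixes I :: "'r::ring_1 set" and bar :: "'r \<Rightarrow> 'r" and d :: "'r \<Rightarrow> real"
  assumes basis_independent: "int_module.independent I"
    and basis_span: "int_module.span I = UNIV"
    and countable_basis: "countable I"
    and unit_in_basis: "1 \<in> I"
    and fusion_coeff_nonneg:
      "\<And>\<xi> \<eta> \<alpha>. \<lbrakk>\<xi> \<in> I; \<eta> \<in> I; \<alpha> \<in> I\<rbrakk> \<Longrightarrow> 0 \<le> fusion_coeff I \<xi> \<eta> \<alpha>"
    and bar_linear: "module_hom int_scale int_scale bar"
    and bar_mult: "\<And>x y. bar (x * y) = bar y * bar x"
    and bar_bar: "\<And>x. bar (bar x) = x"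
    and bar_basis: "bar ` I = I"
    and frobenius_left:
      "\<And>\<xi> \<eta> \<alpha>. \<lbrakk>\<xi> \<in> I; \<eta> \<in> I; \<alpha> \<in> I\<rbrakk> \<Longrightarrow> fusion_coeff I \<xi> \<eta> \<alpha> = fusion_coeff I (bar \<xi>) \<alpha> \<eta>"
    and frobenius_right:
      "\<And>\<xi> \<eta> \<alpha>. \<lbrakk>\<xi> \<in> I; \<eta> \<in> I; \<alpha> \<in> I\<rbrakk> \<Longrightarrow> fusion_coeff I \<xi> \<eta> \<alpha> = fusion_coeff I \<alpha> (bar \<eta>) \<xi>"
    and dim_linear: "module_hom int_scale int_scale d"
    and dim_mult: "\<And>x y. d (x * y) = d x * d y"
    and dim_ge_1: "\<And>\<xi>. \<xi> \<in> I \<Longrightarrow> 1 \<le> d \<xi>"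
    and dim_bar: "\<And>\<xi>. \<xi> \<in> I \<Longrightarrow> d (bar \<xi>) = d \<xi>"

text \<open>
  Functions on \<open>I\<close> are represented by functions on the whole ring; only their values on \<open>I\<close> matter,
  and the elements of the function spaces below are normalised to vanish outside \<open>I\<close>.
\<close>

definition fun_supp :: "'r set \<Rightarrow> ('r \<Rightarrow> 'a::zero) \<Rightarrow> 'r set"
  where "fun_supp I f = {\<alpha> \<in> I. f \<alpha> \<noteq> 0}"

text \<open>\<open>dirac_conv I d \<xi> \<eta>\<close> is the density of \<open>\<delta>\<^sub>\<xi> * \<delta>\<^sub>\<eta>\<close>.\<close>

definition dirac_conv :: "'r::ring_1 set \<Rightarrow> ('r \<Rightarrow> real) \<Rightarrow> 'r \<Rightarrow> 'r \<Rightarrow> 'r \<Rightarrow> real"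
  where "dirac_conv I d \<xi> \<eta> \<alpha> = d \<alpha> / (d \<xi> * d \<eta>) * of_int (fusion_coeff I \<xi> \<eta> \<alpha>)"

definition fusion_conv ::
    "'r::ring_1 set \<Rightarrow> ('r \<Rightarrow> real) \<Rightarrow> ('r \<Rightarrow> real) \<Rightarrow> ('r \<Rightarrow> real) \<Rightarrow> 'r \<Rightarrow> real"
  where "fusion_conv I d f g \<alpha> =
    (\<Sum>\<^sub>\<infinity>(\<xi>, \<eta>) \<in> I \<times> I. f \<xi> * g \<eta> * dirac_conv I d \<xi> \<eta> \<alpha>)"

definition dim_measure :: "('r \<Rightarrow> real) \<Rightarrow> 'r \<Rightarrow> real"
  where "dim_measure d \<xi> = (d \<xi>)\<^sup>2"

text \<open>
  The space \<open>\<ell>\<^sup>p(I, w)\<close> of complex functions for the weight \<open>w\<close> and \<open>1 \<le> p < \<infinity>\<close>, and its norm.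
\<close>

definition lp_space :: "'r set \<Rightarrow> ('r \<Rightarrow> real) \<Rightarrow> nat \<Rightarrow> ('r \<Rightarrow> complex) set"
  where "lp_space I w p =
    {f. (\<forall>\<eta>. \<eta> \<notin> I \<longrightarrow> f \<eta> = 0) \<and> (\<lambda>\<eta>. cmod (f \<eta>) ^ p * w \<eta>) summable_on I}"

definition lp_norm :: "'r set \<Rightarrow> ('r \<Rightarrow> real) \<Rightarrow> nat \<Rightarrow> ('r \<Rightarrow> complex) \<Rightarrow> real"
  where "lp_norm I w p f = root p (\<Sum>\<^sub>\<infinity>\<eta>\<in>I. cmod (f \<eta>) ^ p * w \<eta>)"

text \<open>
  Bounded operators on \<open>\<ell>\<^sup>p(I, w)\<close>, given as maps on all functions of which only the restriction to
  \<open>\<ell>\<^sup>p(I, w)\<close> matters, and the spectrum of such an operator in the algebra \<open>B(\<ell>\<^sup>p(I, w))\<close>.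
\<close>

definition lp_bounded_op ::
    "'r set \<Rightarrow> ('r \<Rightarrow> real) \<Rightarrow> nat \<Rightarrow> (('r \<Rightarrow> complex) \<Rightarrow> 'r \<Rightarrow> complex) \<Rightarrow> bool"
  where "lp_bounded_op I w p T \<longleftrightarrow>
    (\<forall>f \<in> lp_space I w p. T f \<in> lp_space I w p) \<and>
    (\<forall>f \<in> lp_space I w p. \<forall>g \<in> lp_space I w p.
      T (\<lambda>\<eta>. f \<eta> + g \<eta>) = (\<lambda>\<eta>. T f \<eta> + T g \<eta>)) \<and>
    (\<forall>f \<in> lp_space I w p. \<forall>c. T (\<lambda>\<eta>. c * f \<eta>) = (\<lambda>\<eta>. c * T f \<eta>)) \<and>
    (\<exists>C. \<forall>f \<in> lp_space I w p. lp_norm I w p (T f) \<le> C * lp_norm I w p f)"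

definition lp_spectrum ::
    "'r set \<Rightarrow> ('r \<Rightarrow> real) \<Rightarrow> nat \<Rightarrow> (('r \<Rightarrow> complex) \<Rightarrow> 'r \<Rightarrow> complex) \<Rightarrow> complex set"
  where "lp_spectrum I w p T =
    {z. \<not> (\<exists>S. lp_bounded_op I w p S \<and>
      (\<forall>f \<in> lp_space I w p.
        S (\<lambda>\<eta>. T f \<eta> - z * f \<eta>) = f \<and> (\<lambda>\<eta>. T (S f) \<eta> - z * S f \<eta>) = f))}"

text \<open>
  For \<open>f \<in> \<ell>\<^sup>\<infinity>(I)\<close> the sums over \<open>I\<close> have only finitely many non-zero terms.  The operators on
  the spaces \<open>\<ell>\<^sup>p(I, w)\<close> are the restrictions of those defined here.
\<close>

definition left_op ::
    "'r::ring_1 set \<Rightarrow> ('r \<Rightarrow> 'r) \<Rightarrow> ('r \<Rightarrow> real) \<Rightarrow> 'r \<Rightarrow> ('r \<Rightarrow> complex) \<Rightarrow> 'r \<Rightarrow> complex"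
  where "left_op I bar d \<xi> f \<eta> =
    (if \<eta> \<in> I then \<Sum>\<^sub>\<infinity>\<alpha>\<in>I. f \<alpha> * complex_of_real (dirac_conv I d (bar \<xi>) \<eta> \<alpha>) else 0)"

definition right_op ::
    "'r::ring_1 set \<Rightarrow> ('r \<Rightarrow> real) \<Rightarrow> 'r \<Rightarrow> ('r \<Rightarrow> complex) \<Rightarrow> 'r \<Rightarrow> complex"
  where "right_op I d \<xi> f \<eta> =
    (if \<eta> \<in> I then \<Sum>\<^sub>\<infinity>\<alpha>\<in>I. f \<alpha> * complex_of_real (dirac_conv I d \<eta> \<xi> \<alpha>) else 0)"

text \<open>For finitely supported \<open>\<mu>\<close> only.\<close>

definition left_op_measure ::
    "'r::ring_1 set \<Rightarrow> ('r \<Rightarrow> 'r) \<Rightarrow> ('r \<Rightarrow> real) \<Rightarrow> ('r \<Rightarrow> real) \<Rightarrow>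
      ('r \<Rightarrow> complex) \<Rightarrow> 'r \<Rightarrow> complex"
  where "left_op_measure I bar d \<mu> f \<eta> =
    (\<Sum>\<xi>\<in>fun_supp I \<mu>. complex_of_real (\<mu> \<xi>) * left_op I bar d \<xi> f \<eta>)"

definition fin_symm_prob :: "'r set \<Rightarrow> ('r \<Rightarrow> 'r) \<Rightarrow> 'r pmf \<Rightarrow> bool"
  where "fin_symm_prob I bar \<mu> \<longleftrightarrow>
    set_pmf \<mu> \<subseteq> I \<and> finite (set_pmf \<mu>) \<and> (\<forall>\<xi>\<in>I. pmf \<mu> (bar \<xi>) = pmf \<mu> \<xi>)"

definition boundary :: "'r::ring_1 set \<Rightarrow> 'r set \<Rightarrow> 'r set \<Rightarrow> 'r set"
  where "boundary I S F =
    {\<alpha> \<in> F. \<exists>\<xi>\<in>S. \<not> basis_supp I (\<alpha> * \<xi>) \<subseteq> F} \<union>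
    {\<alpha> \<in> I - F. \<exists>\<xi>\<in>S. \<not> basis_supp I (\<alpha> * \<xi>) \<subseteq> I - F}"

definition amenable :: "'r::ring_1 set \<Rightarrow> ('r \<Rightarrow> 'r) \<Rightarrow> ('r \<Rightarrow> real) \<Rightarrow> bool"
  where "amenable I bar d \<longleftrightarrow>
    (\<forall>\<mu>. fin_symm_prob I bar \<mu> \<longrightarrow>
      1 \<in> lp_spectrum I (dim_measure d) 2 (left_op_measure I bar d (pmf \<mu>)))"

definition folner_FC1 :: "'r::ring_1 set \<Rightarrow> ('r \<Rightarrow> 'r) \<Rightarrow> ('r \<Rightarrow> real) \<Rightarrow> bool"
  where "folner_FC1 I bar d \<longleftrightarrow>
    (\<forall>\<mu> \<epsilon>. fin_symm_prob I bar \<mu> \<and> 1 \<in> set_pmf \<mu> \<and> \<epsilon> > 0 \<longrightarrow>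
      (\<exists>F. finite F \<and> F \<subseteq> I \<and>
        (\<Sum>\<xi> \<in> fun_supp I (fusion_conv I d (indicator F) (pmf \<mu>)). (d \<xi>)\<^sup>2)
          < (1 + \<epsilon>) * (\<Sum>\<xi>\<in>F. (d \<xi>)\<^sup>2)))"

definition folner_FC2 :: "'r::ring_1 set \<Rightarrow> ('r \<Rightarrow> real) \<Rightarrow> bool"
  where "folner_FC2 I d \<longleftrightarrow>
    (\<forall>S \<epsilon>. finite S \<and> S \<noteq> {} \<and> S \<subseteq> I \<and> \<epsilon> > 0 \<longrightarrow>
      (\<exists>F. finite F \<and> F \<subseteq> I \<and>
        (\<forall>\<xi>\<in>S. lp_norm I (dim_measure d) 1
            (\<lambda>\<eta>. right_op I d \<xi> (indicator F) \<eta> - indicator F \<eta>)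
          < \<epsilon> * lp_norm I (dim_measure d) 1 (indicator F))))"

definition folner_FC3 :: "'r::ring_1 set \<Rightarrow> ('r \<Rightarrow> real) \<Rightarrow> bool"
  where "folner_FC3 I d \<longleftrightarrow>
    (\<forall>S \<epsilon>. finite S \<and> S \<noteq> {} \<and> S \<subseteq> I \<and> \<epsilon> > 0 \<longrightarrow>
      (\<exists>F. finite F \<and> F \<subseteq> I \<and>
        (\<Sum>\<xi> \<in> boundary I S F. (d \<xi>)\<^sup>2) < \<epsilon> * (\<Sum>\<xi>\<in>F. (d \<xi>)\<^sup>2)))"

end

theory Submission
  imports Defs
begin

text \<open>
  For a finitely supported symmetric probability measure \<open>\<mu>\<close>, \<open>\<lambda>\<^sub>\<mu>\<close> is a Markov operator on \<open>I\<close>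
  that is reversible with respect to \<open>\<sigma> = d\<^sup>2\<close>, and Frobenius reciprocity makes every
  nonzero transition probability of \<open>\<xi>\<close> at least \<open>1 / d(\<xi>)\<^sup>2\<close>.

  If (FC1) fails for \<open>\<mu>\<close>, the walk therefore satisfies a linear isoperimetric inequality.  By Cheeger's
  argument, together with \<open>\<mu>(1) > 0\<close>, the operator \<open>\<lambda>\<^sub>\<mu>\<close> has norm less than 1 on \<open>\<ell>\<^sup>2\<close>, so the Neumann
  series inverts \<open>\<lambda>\<^sub>\<mu> - 1\<close>; hence (A) implies (FC1).  The inner boundary of a set lies in the
  neighbourhood of its outer boundary, and \<open>\<sigma>(supp (\<beta> \<xi>)) \<le> d(\<beta>)\<^sup>2 d(\<xi>)\<^sup>2\<close>; hence (FC1) implies (FC3).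
  The function \<open>\<rho>\<^sub>\<xi> \<chi>\<^sub>F - \<chi>\<^sub>F\<close> is bounded by 1 and vanishes off the boundary of \<open>F\<close>; hence (FC3) implies
  (FC2).  By the same bound \<open>\<chi>\<^sub>F\<close> is an approximate eigenvector of \<open>\<rho>\<^sub>\<mu>\<close> in \<open>\<ell>\<^sup>2\<close>, and conjugation by the
  involution turns right convolution into left convolution; hence (FC2) implies (A).
\<close>

section \<open>A finite Cheeger inequality\<close>

text \<open>When \<open>g\<close> is an indicator this is \<open>iso\<close>. In general
  \<open>g\<close> is a positive combination of indicators of its nested superlevel sets, and both
  sides are additive along such a chain.\<close>

lemma coarea_ineq:
  fixes a :: "'a \<Rightarrow> 'a \<Rightarrow> real" and g w :: "'a \<Rightarrow> real"
  assumes K: "finite K" "F \<subseteq> K"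
    and a: "\<And>x y. x \<in> K \<Longrightarrow> y \<in> K \<Longrightarrow> 0 \<le> a x y"
    and iso: "\<And>G. G \<subseteq> F \<Longrightarrow> \<kappa> * sum w G \<le> (\<Sum>x\<in>G. \<Sum>y\<in>K - G. a x y)"
    and g: "\<And>x. 0 \<le> g x" "\<And>x. x \<notin> F \<Longrightarrow> g x = 0"
  shows "\<kappa> * (\<Sum>x\<in>K. w x * g x) \<le> (\<Sum>x\<in>K. \<Sum>y\<in>K. a x y * max 0 (g x - g y))"
  using g
  \<comment> \<open>peel off the multiple \<open>t\<close> of the indicator of the support of \<open>g\<close>, where \<open>t\<close> is the least
    positive value of \<open>g\<close>\<close>
proof (induction "card {x \<in> K. g x \<noteq> 0}" arbitrary: g rule: less_induct)
  case less
  define G where "G = {x \<in> K. g x \<noteq> 0}"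
  have GF: "G \<subseteq> F" "G \<subseteq> K" "finite G"
    using K less.prems by (auto simp: G_def)
  show ?case
  proof (cases "G = {}")
    case True
    then have "g x = 0" if "x \<in> K" for x using that by (auto simp: G_def)
    then show ?thesis by simp
  next
    case False
    define t where "t = Min (g ` G)"
    have t_le: "t \<le> g x" if "x \<in> G" for x using that GF by (simp add: t_def)
    have "t \<in> g ` G" unfolding t_def using False GF by (intro Min_in) auto
    then obtain x0 where x0: "x0 \<in> G" "g x0 = t" by auto
    have "t > 0" using x0 less.prems(1)[of x0] by (auto simp: G_def less_le)
    define h where "h x = g x - t * indicator G x" for x
    have h: "0 \<le> h x" "x \<notin> F \<Longrightarrow> h x = 0" for x
      using t_le[of x] less.prems[of x] GF by (auto simp: h_def indicator_def)
    have "{x \<in> K. h x \<noteq> 0} \<subset> G"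
    proof
      show "{x \<in> K. h x \<noteq> 0} \<subseteq> G" by (auto simp: h_def G_def)
      show "{x \<in> K. h x \<noteq> 0} \<noteq> G"
      proof
        assume "{x \<in> K. h x \<noteq> 0} = G"
        with x0 have "h x0 \<noteq> 0" by blast
        with x0 show False by (simp add: h_def)
      qed
    qed
    then have "card {x \<in> K. h x \<noteq> 0} < card {x \<in> K. g x \<noteq> 0}"
      using GF by (simp add: G_def[symmetric] psubset_card_mono)
    from less.hyps[OF this h]
    have IH: "\<kappa> * (\<Sum>x\<in>K. w x * h x) \<le> (\<Sum>x\<in>K. \<Sum>y\<in>K. a x y * max 0 (h x - h y))" .
    have split: "max 0 (g x - g y) = max 0 (h x - h y) + t * (indicator G x * indicator (K - G) y)"
      if "x \<in> K" "y \<in> K" for x y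
      using that t_le[of x] t_le[of y] \<open>t > 0\<close> less.prems(1)[of x] less.prems(1)[of y]
      by (auto simp: h_def indicator_def G_def)
    have "(\<Sum>x\<in>K. \<Sum>y\<in>K. a x y * max 0 (g x - g y))
        = (\<Sum>x\<in>K. \<Sum>y\<in>K. a x y * max 0 (h x - h y)
            + t * (indicator G x * (a x y * indicator (K - G) y)))"
      by (intro sum.cong refl) (simp add: split algebra_simps)
    also have "\<dots> = (\<Sum>x\<in>K. \<Sum>y\<in>K. a x y * max 0 (h x - h y))
        + t * (\<Sum>x\<in>K. indicator G x * (\<Sum>y\<in>K. a x y * indicator (K - G) y))"
      by (simp add: sum.distrib sum_distrib_left)
    also have "(\<Sum>x\<in>K. indicator G x * (\<Sum>y\<in>K. a x y * indicator (K - G) y))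
        = (\<Sum>x\<in>G. \<Sum>y\<in>K - G. a x y)"
    proof -
      have "(\<Sum>y\<in>K. a x y * indicator (K - G) y) = (\<Sum>y\<in>K - G. a x y)" for x
        using K by (intro sum.mono_neutral_cong_right) (auto simp: indicator_def)
      then show ?thesis
        using K GF by (intro sum.mono_neutral_cong_right) (auto simp: indicator_def)
    qed
    finally have eq: "(\<Sum>x\<in>K. \<Sum>y\<in>K. a x y * max 0 (g x - g y))
        = (\<Sum>x\<in>K. \<Sum>y\<in>K. a x y * max 0 (h x - h y)) + t * (\<Sum>x\<in>G. \<Sum>y\<in>K - G. a x y)" .
    have "(\<Sum>x\<in>K. w x * g x) = (\<Sum>x\<in>K. w x * h x + t * (w x * indicator G x))"
      by (intro sum.cong refl) (simp add: h_def algebra_simps)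
    also have "\<dots> = (\<Sum>x\<in>K. w x * h x) + t * (\<Sum>x\<in>K. w x * indicator G x)"
      by (simp add: sum.distrib sum_distrib_left)
    also have "(\<Sum>x\<in>K. w x * indicator G x) = sum w G"
      using K GF by (intro sum.mono_neutral_cong_right) (auto simp: indicator_def)
    finally have "\<kappa> * (\<Sum>x\<in>K. w x * g x) = \<kappa> * (\<Sum>x\<in>K. w x * h x) + t * (\<kappa> * sum w G)"
      by (simp add: algebra_simps)
    also have "\<dots> \<le> (\<Sum>x\<in>K. \<Sum>y\<in>K. a x y * max 0 (h x - h y)) + t * (\<Sum>x\<in>G. \<Sum>y\<in>K - G. a x y)"
      using IH iso[OF GF(1)] \<open>t > 0\<close> by (intro add_mono mult_left_mono) auto
    finally show ?thesis by (simp add: eq)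
  qed
qed

text \<open>Two bounds on the energy \<open>D\<close> are combined. Isoperimetry makes
  \<open>D\<close> at least a multiple of the squared norm \<open>M\<close> (Cheeger), and laziness
  makes one step of the kernel lose at least \<open>\<delta> / 2 * D\<close> from \<open>M\<close>.
  The set \<open>K\<close> is a finite window, so its rows may have mass less than 1.\<close>

lemma cheeger_contraction:
  fixes p :: "'a \<Rightarrow> 'a \<Rightarrow> real" and f w :: "'a \<Rightarrow> real"
  assumes K: "finite K" "F \<subseteq> K"
    and w: "\<And>x. x \<in> K \<Longrightarrow> 0 \<le> w x"
    and p: "\<And>x y. x \<in> K \<Longrightarrow> y \<in> K \<Longrightarrow> 0 \<le> p x y"
    and sub: "\<And>x. x \<in> K \<Longrightarrow> (\<Sum>y\<in>K. p x y) \<le> 1"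
    and rev: "\<And>x y. x \<in> K \<Longrightarrow> y \<in> K \<Longrightarrow> w x * p x y = w y * p y x"
    and lazy: "0 \<le> \<delta>" "\<And>x. x \<in> K \<Longrightarrow> \<delta> \<le> p x x"
    and iso: "0 < \<kappa>" "\<And>G. G \<subseteq> F \<Longrightarrow> \<kappa> * sum w G \<le> (\<Sum>x\<in>G. \<Sum>y\<in>K - G. w x * p x y)"
    and f: "\<And>x. 0 \<le> f x" "\<And>x. x \<notin> F \<Longrightarrow> f x = 0"
  shows "(\<Sum>x\<in>K. w x * (\<Sum>y\<in>K. p x y * f y)\<^sup>2) \<le> (1 - \<delta> * \<kappa>\<^sup>2 / 8) * (\<Sum>x\<in>K. w x * (f x)\<^sup>2)"
proof -
  define M where "M = (\<Sum>x\<in>K. w x * (f x)\<^sup>2)"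
  define D where "D = (\<Sum>x\<in>K. \<Sum>y\<in>K. w x * p x y * (f x - f y)\<^sup>2)"
  have col: "(\<Sum>x\<in>K. \<Sum>y\<in>K. w x * p x y * (f y)\<^sup>2) \<le> M"
  proof -
    have "(\<Sum>x\<in>K. \<Sum>y\<in>K. w x * p x y * (f y)\<^sup>2) = (\<Sum>y\<in>K. \<Sum>x\<in>K. w x * p x y * (f y)\<^sup>2)"
      by (rule sum.swap)
    also have "\<dots> = (\<Sum>y\<in>K. (w y * (f y)\<^sup>2) * (\<Sum>x\<in>K. p y x))"
      unfolding sum_distrib_left by (intro sum.cong refl) (simp add: rev algebra_simps)
    also have "\<dots> \<le> (\<Sum>y\<in>K. (w y * (f y)\<^sup>2) * 1)"
      using w sub by (intro sum_mono mult_left_mono) auto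
    finally show ?thesis by (simp add: M_def)
  qed
  have row: "(\<Sum>x\<in>K. \<Sum>y\<in>K. w x * p x y * (f x)\<^sup>2) \<le> M"
  proof -
    have "(\<Sum>x\<in>K. \<Sum>y\<in>K. w x * p x y * (f x)\<^sup>2) = (\<Sum>x\<in>K. (w x * (f x)\<^sup>2) * (\<Sum>y\<in>K. p x y))"
      unfolding sum_distrib_left by (intro sum.cong refl) (simp add: algebra_simps)
    also have "\<dots> \<le> (\<Sum>x\<in>K. (w x * (f x)\<^sup>2) * 1)"
      using w sub by (intro sum_mono mult_left_mono) auto
    finally show ?thesis by (simp add: M_def)
  qed
  have "\<kappa>\<^sup>2 * M \<le> 4 * D"
  proof -
    \<comment> \<open>The coarea inequality is applied to the square of \<open>f\<close>. The
      weights in the next estimate are chosen so that the two terms \<open>\<kappa> / 4 * M\<close>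
      use up only half of the left side.\<close>
    have "\<kappa> * (\<Sum>x\<in>K. w x * (f x)\<^sup>2) \<le> (\<Sum>x\<in>K. \<Sum>y\<in>K. w x * p x y * max 0 ((f x)\<^sup>2 - (f y)\<^sup>2))"
      using K w p iso f by (intro coarea_ineq[where F = F]) auto
    also have "\<dots> \<le> (\<Sum>x\<in>K. \<Sum>y\<in>K. w x * p x y *
        (2 / \<kappa> * (f x - f y)\<^sup>2 + \<kappa> / 4 * (f x)\<^sup>2 + \<kappa> / 4 * (f y)\<^sup>2))"
    proof (intro sum_mono mult_left_mono)
      fix x y
      \<comment> \<open>AM-GM: \<open>\<bar>u\<bar> v \<le> 2 u\<^sup>2 / \<kappa> + \<kappa> v\<^sup>2 / 8\<close> with \<open>u = f x - f y\<close> and \<open>v = f x + f y\<close>\<close>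
      have "(f x)\<^sup>2 - (f y)\<^sup>2 = (f x - f y) * (f x + f y)"
        by (simp add: power2_eq_square algebra_simps)
      also have "\<dots> \<le> 2 / \<kappa> * (f x - f y)\<^sup>2 + \<kappa> / 8 * (f x + f y)\<^sup>2"
      proof -
        have "0 \<le> (4 * (f x - f y) - \<kappa> * (f x + f y))\<^sup>2 / (8 * \<kappa>)"
          using iso(1) by simp
        also have "\<dots> = 2 / \<kappa> * (f x - f y)\<^sup>2 + \<kappa> / 8 * (f x + f y)\<^sup>2 - (f x - f y) * (f x + f y)"
          using iso(1) by (simp add: field_simps power2_eq_square)
        finally show ?thesis by simp
      qed
      also have "\<kappa> / 8 * (f x + f y)\<^sup>2 \<le> \<kappa> / 8 * (2 * (f x)\<^sup>2 + 2 * (f y)\<^sup>2)"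
        using iso(1) sum_squares_ge_zero[of "f x - f y" 0]
        by (intro mult_left_mono) (simp_all add: power2_eq_square algebra_simps)
      finally show "max 0 ((f x)\<^sup>2 - (f y)\<^sup>2)
          \<le> 2 / \<kappa> * (f x - f y)\<^sup>2 + \<kappa> / 4 * (f x)\<^sup>2 + \<kappa> / 4 * (f y)\<^sup>2"
        using iso(1) by (simp add: algebra_simps)
    qed (use w p in auto)
    also have "\<dots> = 2 / \<kappa> * D + \<kappa> / 4 * (\<Sum>x\<in>K. \<Sum>y\<in>K. w x * p x y * (f x)\<^sup>2)
        + \<kappa> / 4 * (\<Sum>x\<in>K. \<Sum>y\<in>K. w x * p x y * (f y)\<^sup>2)"
      unfolding D_def sum_distrib_left sum.distrib[symmetric]
      by (intro sum.cong refl) (simp add: algebra_simps)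
    also have "\<dots> \<le> 2 / \<kappa> * D + \<kappa> / 4 * M + \<kappa> / 4 * M"
      using iso(1) row col by (intro add_mono mult_left_mono) auto
    finally have "\<kappa> * M \<le> 2 / \<kappa> * D + \<kappa> / 4 * M + \<kappa> / 4 * M" by (simp only: M_def)
    then have "\<kappa> / 2 * M \<le> 2 / \<kappa> * D" by linarith
    then have "2 * \<kappa> * (\<kappa> / 2 * M) \<le> 2 * \<kappa> * (2 / \<kappa> * D)"
      by (rule mult_left_mono) (use iso(1) in simp)
    moreover have "2 * \<kappa> * (\<kappa> / 2 * M) = \<kappa>\<^sup>2 * M" by (simp add: power2_eq_square)
    moreover have "2 * \<kappa> * (2 / \<kappa> * D) = 4 * D" using iso(1) by simp
    ultimately show ?thesis by metis
  qed
  then have DM: "\<delta> * (\<kappa>\<^sup>2 * M) \<le> \<delta> * (4 * D)"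
    using lazy(1) by (intro mult_left_mono)
  \<comment> \<open>Jensen's inequality with a remainder: the sum of \<open>?V z\<close> over
    \<open>z\<close> is twice a variance, and its single term \<open>z = x\<close> already carries
    the factor \<open>p x x\<close>, which is at least \<open>\<delta>\<close>.\<close>
  have var: "(\<Sum>y\<in>K. p x y * f y)\<^sup>2
      \<le> (\<Sum>y\<in>K. p x y * (f y)\<^sup>2) - \<delta> / 2 * (\<Sum>y\<in>K. p x y * (f x - f y)\<^sup>2)"
    if x: "x \<in> K" for x
  proof -
    let ?m1 = "\<Sum>y\<in>K. p x y * f y" and ?m2 = "\<Sum>y\<in>K. p x y * (f y)\<^sup>2"
    let ?V = "\<lambda>z. \<Sum>y\<in>K. p x z * (p x y * (f z - f y)\<^sup>2)"
    have nn: "0 \<le> ?V z" if "z \<in> K" for z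
      using that x p by (intro sum_nonneg) auto
    have "\<delta> * (\<Sum>y\<in>K. p x y * (f x - f y)\<^sup>2) \<le> p x x * (\<Sum>y\<in>K. p x y * (f x - f y)\<^sup>2)"
      using x p lazy by (intro mult_right_mono sum_nonneg) auto
    also have "\<dots> = ?V x" by (simp add: sum_distrib_left)
    also have "\<dots> \<le> (\<Sum>z\<in>K. ?V z)"
      using x K nn by (intro member_le_sum) auto
    also have "\<dots> = (\<Sum>z\<in>K. \<Sum>y\<in>K. (p x z * (f z)\<^sup>2) * p x y + p x z * (p x y * (f y)\<^sup>2)
        - 2 * ((p x z * f z) * (p x y * f y)))"
      by (intro sum.cong refl) (simp add: power2_eq_square algebra_simps)
    also have "\<dots> = ?m2 * (\<Sum>y\<in>K. p x y) + (\<Sum>y\<in>K. p x y) * ?m2 - 2 * (?m1 * ?m1)"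
      by (simp add: sum.distrib sum_subtractf sum_distrib_left[symmetric] sum_distrib_right[symmetric])
    also have "\<dots> \<le> ?m2 * 1 + 1 * ?m2 - 2 * (?m1 * ?m1)"
      using sub[OF x] p x
      by (intro diff_mono add_mono mult_left_mono mult_right_mono sum_nonneg) auto
    finally show ?thesis by (simp add: power2_eq_square)
  qed
  have "(\<Sum>x\<in>K. w x * (\<Sum>y\<in>K. p x y * f y)\<^sup>2)
      \<le> (\<Sum>x\<in>K. w x * ((\<Sum>y\<in>K. p x y * (f y)\<^sup>2) - \<delta> / 2 * (\<Sum>y\<in>K. p x y * (f x - f y)\<^sup>2)))"
    using var w by (intro sum_mono mult_left_mono) auto
  also have "\<dots> = (\<Sum>x\<in>K. \<Sum>y\<in>K. w x * p x y * (f y)\<^sup>2) - \<delta> / 2 * D"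
    unfolding D_def sum_distrib_left sum_subtractf[symmetric] right_diff_distrib
    by (intro sum.cong refl) (simp add: algebra_simps)
  also have "\<dots> \<le> M - \<delta> / 2 * D" using col by simp
  also have "\<dots> \<le> (1 - \<delta> * \<kappa>\<^sup>2 / 8) * M"
    using DM by (simp add: algebra_simps)
  finally show ?thesis by (simp add: M_def)
qed

section \<open>Reversible Markov kernels\<close>

lemma lp_space_2I:
  assumes "\<And>\<eta>. \<eta> \<notin> I \<Longrightarrow> f \<eta> = 0" "0 \<le> C" "\<And>\<eta>. \<eta> \<in> I \<Longrightarrow> 0 \<le> w \<eta>"
    and bound: "\<And>G. finite G \<Longrightarrow> G \<subseteq> I \<Longrightarrow> (\<Sum>\<eta>\<in>G. cmod (f \<eta>) ^ 2 * w \<eta>) \<le> C\<^sup>2"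
  shows "f \<in> lp_space I w 2" "lp_norm I w 2 f \<le> C"
proof -
  have s: "(\<lambda>\<eta>. cmod (f \<eta>) ^ 2 * w \<eta>) summable_on I"
    using assms by (intro nonneg_bdd_above_summable_on bdd_aboveI[where M = "C\<^sup>2"]) auto
  then show "f \<in> lp_space I w 2" using assms by (simp add: lp_space_def)
  have "infsum (\<lambda>\<eta>. cmod (f \<eta>) ^ 2 * w \<eta>) I \<le> C\<^sup>2"
    using s bound by (rule infsum_le_finite_sums)
  then have "sqrt (infsum (\<lambda>\<eta>. cmod (f \<eta>) ^ 2 * w \<eta>) I) \<le> C"
    using \<open>0 \<le> C\<close> by (intro real_le_lsqrt) auto
  then show "lp_norm I w 2 f \<le> C" by (simp add: lp_norm_def sqrt_def)
qed

text \<open>The abstract form of the walk driven by a symmetric measure, with \<open>w\<close> in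
  the role of the squared dimension. The axiom \<open>reversible\<close> is detailed balance, that
  is, symmetry of the operator for the weight \<open>w\<close>.\<close>

locale markov_kernel =
  fixes I :: "'a set" and w :: "'a \<Rightarrow> real" and p :: "'a \<Rightarrow> 'a \<Rightarrow> real"
  assumes w_ge_1: "\<And>x. x \<in> I \<Longrightarrow> 1 \<le> w x"
    and p_nonneg: "\<And>x y. x \<in> I \<Longrightarrow> y \<in> I \<Longrightarrow> 0 \<le> p x y"
    and finite_row: "\<And>x. x \<in> I \<Longrightarrow> finite {y \<in> I. p x y \<noteq> 0}"
    and row_sum: "\<And>x. x \<in> I \<Longrightarrow> (\<Sum>y | y \<in> I \<and> p x y \<noteq> 0. p x y) = 1"
    and reversible: "\<And>x y. x \<in> I \<Longrightarrow> y \<in> I \<Longrightarrow> w x * p x y = w y * p y x"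
begin

definition nbhd :: "'a \<Rightarrow> 'a set"
  where "nbhd x = {y \<in> I. p x y \<noteq> 0}"

definition markov_op :: "('a \<Rightarrow> complex) \<Rightarrow> 'a \<Rightarrow> complex"
  where "markov_op f x = (if x \<in> I then \<Sum>y\<in>nbhd x. f y * complex_of_real (p x y) else 0)"

lemma w_nonneg: "x \<in> I \<Longrightarrow> 0 \<le> w x"
  using w_ge_1[of x] by linarith

lemma finite_nbhd: "x \<in> I \<Longrightarrow> finite (nbhd x)"
  using finite_row by (simp add: nbhd_def)

lemma nbhd_subset: "nbhd x \<subseteq> I"
  by (auto simp: nbhd_def)

lemma sum_nbhd:
  assumes "finite H" "H \<subseteq> I" "nbhd x \<subseteq> H" "\<And>y. p x y = 0 \<Longrightarrow> g y = 0"
  shows "sum g (nbhd x) = sum g H"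
  using assms by (intro sum.mono_neutral_left) (auto simp: nbhd_def)

lemma row_sum_finite_le:
  assumes "finite H" "H \<subseteq> I" "x \<in> I"
  shows "(\<Sum>y\<in>H. p x y) \<le> 1"
proof -
  have "(\<Sum>y\<in>H. p x y) \<le> (\<Sum>y\<in>H \<union> nbhd x. p x y)"
    using assms nbhd_subset finite_nbhd by (intro sum_mono2) (auto intro!: p_nonneg)
  also have "\<dots> = (\<Sum>y\<in>nbhd x. p x y)"
    using assms nbhd_subset finite_nbhd by (intro sum_nbhd[symmetric]) auto
  also have "\<dots> = 1" using row_sum[OF assms(3)] by (simp add: nbhd_def)
  finally show ?thesis .
qed

lemma row_sum_superset:
  assumes "finite H" "H \<subseteq> I" "x \<in> I" "nbhd x \<subseteq> H"
  shows "(\<Sum>y\<in>H. p x y) = 1"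
  using sum_nbhd[of H x "p x"] row_sum[OF assms(3)] assms by (simp add: nbhd_def)

lemma markov_op_eq:
  assumes "finite H" "H \<subseteq> I" "nbhd x \<subseteq> H" "x \<in> I"
  shows "markov_op f x = (\<Sum>y\<in>H. f y * complex_of_real (p x y))"
  using sum_nbhd[of H x "\<lambda>y. f y * complex_of_real (p x y)"] assms by (simp add: markov_op_def)

text \<open>Restricting \<open>f\<close> to the finitely many neighbours of \<open>G\<close> does not change \<open>markov_op f\<close> on \<open>G\<close>,
  so the finite Cheeger bound passes to all of \<open>\<ell>\<^sup>2\<close> without a density argument.\<close>

lemma markov_op_contraction:
  assumes lazy: "0 \<le> \<delta>" "\<And>x. x \<in> I \<Longrightarrow> \<delta> \<le> p x x"
    and iso: "0 < \<kappa>" "\<And>G. finite G \<Longrightarrow> G \<subseteq> I \<Longrightarrow>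
      \<kappa> * sum w G \<le> (\<Sum>x\<in>G. w x * (1 - (\<Sum>y\<in>G. p x y)))"
    and q: "0 \<le> q" "1 - \<delta> * \<kappa>\<^sup>2 / 8 \<le> q"
    and f: "f \<in> lp_space I w 2"
    and G: "finite G" "G \<subseteq> I"
  shows "(\<Sum>\<eta>\<in>G. cmod (markov_op f \<eta>) ^ 2 * w \<eta>) \<le> q * (\<Sum>\<^sub>\<infinity>\<eta>\<in>I. cmod (f \<eta>) ^ 2 * w \<eta>)"
proof -
  define F where "F = (\<Union>x\<in>G. nbhd x)"
  \<comment> \<open>Adding the neighbours of \<open>F\<close> ensures that no mass starting in
    \<open>F\<close> leaves \<open>K\<close> in one step. For subsets of \<open>F\<close>, the
    deficit \<open>1 - (\<Sum>y\<in>G'. p x y)\<close> is then exactly the flow into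
    \<open>K - G'\<close>.\<close>
  define K where "K = F \<union> G \<union> (\<Union>x\<in>F. nbhd x)"
  have F: "finite F" "F \<subseteq> I" using G finite_nbhd nbhd_subset by (auto simp: F_def)
  have K: "finite K" "K \<subseteq> I" "F \<subseteq> K" "G \<subseteq> K"
    using F G finite_nbhd nbhd_subset by (auto simp: K_def subset_iff)
  have nbF: "nbhd x \<subseteq> K" if "x \<in> F" for x using that by (auto simp: K_def)
  have nbG: "nbhd x \<subseteq> K" if "x \<in> G" for x using that by (auto simp: K_def F_def)
  \<comment> \<open>The finite inequality is for nonnegative functions. Passing to moduli is
    harmless, since by the triangle inequality it can only increase the image.\<close>
  define h where "h y = cmod (f y) * indicator F y" for y
  have "(\<Sum>\<eta>\<in>G. cmod (markov_op f \<eta>) ^ 2 * w \<eta>) \<le> (\<Sum>\<eta>\<in>G. w \<eta> * (\<Sum>y\<in>K. p \<eta> y * h y)\<^sup>2)"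
  proof (rule sum_mono)
    fix x assume x: "x \<in> G"
    have "cmod (markov_op f x) \<le> (\<Sum>y\<in>K. cmod (f y * complex_of_real (p x y)))"
      using x G K nbG by (subst markov_op_eq[of K]) (auto intro: norm_sum)
    also have "\<dots> = (\<Sum>y\<in>K. p x y * h y)"
    proof (rule sum.cong)
      fix y assume y: "y \<in> K"
      show "cmod (f y * complex_of_real (p x y)) = p x y * h y"
      proof (cases "p x y = 0")
        case False
        with x y K have "y \<in> F" by (auto simp: F_def nbhd_def)
        with x y G K show ?thesis by (simp add: h_def norm_mult p_nonneg subset_iff)
      qed simp
    qed simp
    finally have "cmod (markov_op f x) ^ 2 \<le> (\<Sum>y\<in>K. p x y * h y)\<^sup>2"
      by (intro power_mono) auto
    then show "cmod (markov_op f x) ^ 2 * w x \<le> w x * (\<Sum>y\<in>K. p x y * h y)\<^sup>2"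
      using x G w_nonneg by (subst mult.commute, intro mult_left_mono) auto
  qed
  also have "\<dots> \<le> (\<Sum>\<eta>\<in>K. w \<eta> * (\<Sum>y\<in>K. p \<eta> y * h y)\<^sup>2)"
    using K w_nonneg by (intro sum_mono2) auto
  also have "\<dots> \<le> (1 - \<delta> * \<kappa>\<^sup>2 / 8) * (\<Sum>x\<in>K. w x * (h x)\<^sup>2)"
  proof (rule cheeger_contraction[where F = F])
    fix G' assume G': "G' \<subseteq> F"
    have fG': "finite G'" "G' \<subseteq> I" using G' F finite_subset by auto
    have "\<kappa> * sum w G' \<le> (\<Sum>x\<in>G'. w x * (1 - (\<Sum>y\<in>G'. p x y)))"
      using iso(2)[OF fG'] .
    also have "\<dots> = (\<Sum>x\<in>G'. \<Sum>y\<in>K - G'. w x * p x y)"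
    proof (rule sum.cong)
      fix x assume x: "x \<in> G'"
      have "1 = (\<Sum>y\<in>K. p x y)"
        using x G' F K nbF[of x] by (intro row_sum_superset[symmetric]) auto
      also have "\<dots> = (\<Sum>y\<in>K - G'. p x y) + (\<Sum>y\<in>G'. p x y)"
        using K G' by (intro sum.subset_diff) auto
      finally have "1 - (\<Sum>y\<in>G'. p x y) = (\<Sum>y\<in>K - G'. p x y)" by simp
      then show "w x * (1 - (\<Sum>y\<in>G'. p x y)) = (\<Sum>y\<in>K - G'. w x * p x y)"
        by (simp add: sum_distrib_left)
    qed simp
    finally show "\<kappa> * sum w G' \<le> (\<Sum>x\<in>G'. \<Sum>y\<in>K - G'. w x * p x y)" .
  qed (use K w_nonneg p_nonneg row_sum_finite_le reversible lazy iso(1) in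
      \<open>auto simp: h_def subset_iff indicator_def\<close>)
  also have "\<dots> \<le> q * (\<Sum>x\<in>K. w x * (h x)\<^sup>2)"
    using q K w_nonneg by (intro mult_right_mono sum_nonneg) auto
  also have "(\<Sum>x\<in>K. w x * (h x)\<^sup>2) \<le> (\<Sum>x\<in>K. cmod (f x) ^ 2 * w x)"
    using K w_nonneg by (intro sum_mono) (auto simp: h_def indicator_def)
  also have "\<dots> \<le> (\<Sum>\<^sub>\<infinity>\<eta>\<in>I. cmod (f \<eta>) ^ 2 * w \<eta>)"
    using f K w_nonneg by (intro finite_sum_le_infsum) (auto simp: lp_space_def)
  finally show ?thesis using q by (simp add: mult_left_mono)
qed

lemma lp_norm_markov_op_le:
  assumes "0 \<le> \<delta>" "\<And>x. x \<in> I \<Longrightarrow> \<delta> \<le> p x x"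
    and "0 < \<kappa>" "\<And>G. finite G \<Longrightarrow> G \<subseteq> I \<Longrightarrow>
      \<kappa> * sum w G \<le> (\<Sum>x\<in>G. w x * (1 - (\<Sum>y\<in>G. p x y)))"
    and "0 \<le> r" "1 - \<delta> * \<kappa>\<^sup>2 / 8 \<le> r\<^sup>2"
    and "f \<in> lp_space I w 2"
  shows "markov_op f \<in> lp_space I w 2" "lp_norm I w 2 (markov_op f) \<le> r * lp_norm I w 2 f"
proof -
  have nn: "0 \<le> (\<Sum>\<^sub>\<infinity>\<eta>\<in>I. cmod (f \<eta>) ^ 2 * w \<eta>)"
    using w_nonneg by (intro infsum_nonneg) auto
  have "(r * lp_norm I w 2 f)\<^sup>2 = r\<^sup>2 * (\<Sum>\<^sub>\<infinity>\<eta>\<in>I. cmod (f \<eta>) ^ 2 * w \<eta>)"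
    using nn by (simp add: lp_norm_def sqrt_def[symmetric] power_mult_distrib)
  then have *: "(\<Sum>\<eta>\<in>G. cmod (markov_op f \<eta>) ^ 2 * w \<eta>) \<le> (r * lp_norm I w 2 f)\<^sup>2"
    if "finite G" "G \<subseteq> I" for G
    using markov_op_contraction[of \<delta> \<kappa> "r\<^sup>2" f G] assms that by simp
  have "0 \<le> r * lp_norm I w 2 f"
    using nn assms by (simp add: lp_norm_def sqrt_def[symmetric])
  from lp_space_2I[where f = "markov_op f", OF _ this w_nonneg *]
  show "markov_op f \<in> lp_space I w 2" "lp_norm I w 2 (markov_op f) \<le> r * lp_norm I w 2 f"
    by (auto simp: markov_op_def)
qed

section \<open>The weighted space \<open>L2\<close> through its finite sections\<close>

abbreviation "L2 \<equiv> lp_space I w 2"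
abbreviation "norm2 \<equiv> lp_norm I w 2"

lemma norm2_eq: "norm2 f = sqrt (\<Sum>\<^sub>\<infinity>\<eta>\<in>I. cmod (f \<eta>) ^ 2 * w \<eta>)"
  by (simp add: lp_norm_def sqrt_def)

lemma norm2_nonneg: "0 \<le> norm2 f"
  using w_nonneg by (auto simp: norm2_eq intro!: infsum_nonneg)

text \<open>Together with \<open>L2_I\<close> this describes \<open>norm2\<close> by finite
  sections, so that Minkowski's inequality is only needed for finite sums.\<close>

lemma L2_set_le_norm2:
  assumes "f \<in> L2" "finite G" "G \<subseteq> I"
  shows "L2_set (\<lambda>\<eta>. cmod (f \<eta>) * sqrt (w \<eta>)) G \<le> norm2 f"
proof -
  have "(\<Sum>\<eta>\<in>G. (cmod (f \<eta>) * sqrt (w \<eta>))\<^sup>2) = (\<Sum>\<eta>\<in>G. cmod (f \<eta>) ^ 2 * w \<eta>)"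
    using assms w_nonneg by (intro sum.cong) (auto simp: power_mult_distrib)
  also have "\<dots> \<le> (\<Sum>\<^sub>\<infinity>\<eta>\<in>I. cmod (f \<eta>) ^ 2 * w \<eta>)"
    using assms w_nonneg by (intro finite_sum_le_infsum) (auto simp: lp_space_def)
  finally show ?thesis by (simp add: L2_set_def norm2_eq)
qed

lemma L2_I:
  assumes "\<And>\<eta>. \<eta> \<notin> I \<Longrightarrow> f \<eta> = 0" "0 \<le> C"
    and bound: "\<And>G. finite G \<Longrightarrow> G \<subseteq> I \<Longrightarrow> L2_set (\<lambda>\<eta>. cmod (f \<eta>) * sqrt (w \<eta>)) G \<le> C"
  shows "f \<in> L2" "norm2 f \<le> C"
proof -
  have *: "(\<Sum>\<eta>\<in>G. cmod (f \<eta>) ^ 2 * w \<eta>) \<le> C\<^sup>2" if G: "finite G" "G \<subseteq> I" for G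
  proof -
    have "(\<Sum>\<eta>\<in>G. cmod (f \<eta>) ^ 2 * w \<eta>) = (\<Sum>\<eta>\<in>G. (cmod (f \<eta>) * sqrt (w \<eta>))\<^sup>2)"
      using G w_nonneg by (intro sum.cong) (auto simp: power_mult_distrib)
    also have "\<dots> = (L2_set (\<lambda>\<eta>. cmod (f \<eta>) * sqrt (w \<eta>)) G)\<^sup>2"
      by (simp add: L2_set_def sum_nonneg)
    also have "\<dots> \<le> C\<^sup>2" using bound[OF G] by (intro power_mono) auto
    finally show ?thesis .
  qed
  from lp_space_2I[where f = f, OF assms(1,2) w_nonneg *]
  show "f \<in> L2" "norm2 f \<le> C" by auto
qed

text \<open>Point evaluations are contractions because \<open>w\<close> is at least 1. Hence a
  geometrically decaying sequence in \<open>L2\<close> can be summed point by point.\<close>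

lemma cmod_le_norm2:
  assumes "f \<in> L2" "\<eta> \<in> I"
  shows "cmod (f \<eta>) \<le> norm2 f"
proof -
  have "cmod (f \<eta>) * 1 \<le> cmod (f \<eta>) * sqrt (w \<eta>)"
    using w_ge_1[OF assms(2)] by (intro mult_left_mono) auto
  also have "\<dots> \<le> norm2 f" using L2_set_le_norm2[OF assms(1), of "{\<eta>}"] assms(2) w_ge_1[OF assms(2)] by simp
  finally show ?thesis by simp
qed

section \<open>The Neumann series and the spectral value 1\<close>

lemma markov_op_add: "markov_op (\<lambda>\<eta>. f \<eta> + g \<eta>) = (\<lambda>\<eta>. markov_op f \<eta> + markov_op g \<eta>)"
  by (rule ext) (simp add: markov_op_def distrib_right sum.distrib)

lemma markov_op_diff: "markov_op (\<lambda>\<eta>. f \<eta> - g \<eta>) = (\<lambda>\<eta>. markov_op f \<eta> - markov_op g \<eta>)"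
  by (rule ext) (simp add: markov_op_def left_diff_distrib sum_subtractf)

lemma markov_op_cmult: "markov_op (\<lambda>\<eta>. c * f \<eta>) = (\<lambda>\<eta>. c * markov_op f \<eta>)"
  by (rule ext) (simp add: markov_op_def sum_distrib_left mult.assoc)

lemma markov_op_pow_add: "(markov_op ^^ n) (\<lambda>\<eta>. f \<eta> + g \<eta>) = (\<lambda>\<eta>. (markov_op ^^ n) f \<eta> + (markov_op ^^ n) g \<eta>)"
  by (induction n) (simp_all add: markov_op_add)

lemma markov_op_pow_diff: "(markov_op ^^ n) (\<lambda>\<eta>. f \<eta> - g \<eta>) = (\<lambda>\<eta>. (markov_op ^^ n) f \<eta> - (markov_op ^^ n) g \<eta>)"
  by (induction n) (simp_all add: markov_op_diff)

lemma markov_op_pow_cmult: "(markov_op ^^ n) (\<lambda>\<eta>. c * f \<eta>) = (\<lambda>\<eta>. c * (markov_op ^^ n) f \<eta>)"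
  by (induction n) (simp_all add: markov_op_cmult)

text \<open>A strict contraction \<open>T\<close> has \<open>T - 1\<close> invertible by the Neumann
  series. The series is taken pointwise, and its boundedness on \<open>L2\<close> is recovered from
  finite sections.\<close>

lemma one_not_in_spectrum:
  assumes r: "0 \<le> r" "r < 1"
    and contr: "\<And>f. f \<in> L2 \<Longrightarrow> markov_op f \<in> L2" "\<And>f. f \<in> L2 \<Longrightarrow> norm2 (markov_op f) \<le> r * norm2 f"
  shows "1 \<notin> lp_spectrum I w 2 markov_op"
proof -
  \<comment> \<open>The minus sign appears because the inverse of \<open>T - 1\<close>, not of
    \<open>1 - T\<close>, is wanted.\<close>
  define S where "S f \<eta> = - (\<Sum>n. (markov_op ^^ n) f \<eta>)" for f \<eta>
  have pow: "(markov_op ^^ n) f \<in> L2 \<and> norm2 ((markov_op ^^ n) f) \<le> r ^ n * norm2 f" if "f \<in> L2" for f n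
  proof (induction n)
    case (Suc n)
    have "norm2 (markov_op ((markov_op ^^ n) f)) \<le> r * norm2 ((markov_op ^^ n) f)" using Suc contr by blast
    also have "\<dots> \<le> r * (r ^ n * norm2 f)" using Suc r by (intro mult_left_mono) auto
    finally show ?case using Suc contr by (simp add: mult.assoc)
  qed (use that in simp)
  have off: "(markov_op ^^ n) f \<eta> = 0" if "f \<in> L2" "\<eta> \<notin> I" for f n \<eta>
    using pow[OF that(1), of n] that(2) by (auto simp: lp_space_def)
  have summ: "summable (\<lambda>n. (markov_op ^^ n) f \<eta>)" if f: "f \<in> L2" for f \<eta>
  proof (cases "\<eta> \<in> I")
    case True
    have "summable (\<lambda>n. r ^ n * norm2 f)"
      using r by (intro summable_mult2 summable_geometric) auto
    moreover have "norm ((markov_op ^^ n) f \<eta>) \<le> r ^ n * norm2 f" for n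
      using cmod_le_norm2[OF conjunct1[OF pow[OF f]] True, of n] pow[OF f, of n] by linarith
    ultimately show ?thesis by (rule summable_comparison_test'[where N = 0])
  qed (simp add: off[OF f])
  have S_bound: "S f \<in> L2 \<and> norm2 (S f) \<le> 1 / (1 - r) * norm2 f" if f: "f \<in> L2" for f
  proof -
    have "L2_set (\<lambda>\<eta>. cmod (S f \<eta>) * sqrt (w \<eta>)) G \<le> 1 / (1 - r) * norm2 f"
      if G: "finite G" "G \<subseteq> I" for G
    proof -
      let ?s = "\<lambda>N \<eta>. \<Sum>n<N. (markov_op ^^ n) f \<eta>"
      have partial: "L2_set (\<lambda>\<eta>. cmod (?s N \<eta>) * sqrt (w \<eta>)) G \<le> (\<Sum>n<N. r ^ n * norm2 f)" for N
      proof (induction N)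
        case (Suc N)
        have "L2_set (\<lambda>\<eta>. cmod (?s (Suc N) \<eta>) * sqrt (w \<eta>)) G
            \<le> L2_set (\<lambda>\<eta>. cmod (?s N \<eta>) * sqrt (w \<eta>) + cmod ((markov_op ^^ N) f \<eta>) * sqrt (w \<eta>)) G"
          using G w_nonneg
          by (intro L2_set_mono) (auto simp: distrib_right[symmetric] norm_triangle_ineq intro!: mult_right_mono)
        also have "\<dots> \<le> L2_set (\<lambda>\<eta>. cmod (?s N \<eta>) * sqrt (w \<eta>)) G
            + L2_set (\<lambda>\<eta>. cmod ((markov_op ^^ N) f \<eta>) * sqrt (w \<eta>)) G"
          by (rule L2_set_triangle_ineq)
        also have "\<dots> \<le> (\<Sum>n<N. r ^ n * norm2 f) + norm2 ((markov_op ^^ N) f)"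
          using Suc.IH pow[OF f] G by (intro add_mono L2_set_le_norm2) auto
        also have "\<dots> \<le> (\<Sum>n<Suc N. r ^ n * norm2 f)" using pow[OF f, of N] by simp
        finally show ?case .
      qed (simp add: L2_set_def)
      have geo: "(\<Sum>n<N. r ^ n * norm2 f) \<le> 1 / (1 - r) * norm2 f" for N
      proof -
        have "(\<Sum>n<N. r ^ n) \<le> (\<Sum>n. r ^ n)"
          using r by (intro sum_le_suminf summable_geometric) auto
        also have "\<dots> = 1 / (1 - r)" using r by (intro suminf_geometric) auto
        finally show ?thesis
          unfolding sum_distrib_right[symmetric] by (intro mult_right_mono norm2_nonneg)
      qed
      \<comment> \<open>On a finite \<open>G\<close> the section norm is continuous under pointwise
        convergence, so the uniform bound on partial sums survives in the limit.\<close>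
      have "(\<lambda>N. L2_set (\<lambda>\<eta>. cmod (?s N \<eta>) * sqrt (w \<eta>)) G)
          \<longlonglongrightarrow> L2_set (\<lambda>\<eta>. cmod (\<Sum>n. (markov_op ^^ n) f \<eta>) * sqrt (w \<eta>)) G"
        unfolding L2_set_def by (intro tendsto_intros summable_LIMSEQ summ f)
      from LIMSEQ_le_const2[OF this]
      have "L2_set (\<lambda>\<eta>. cmod (\<Sum>n. (markov_op ^^ n) f \<eta>) * sqrt (w \<eta>)) G \<le> 1 / (1 - r) * norm2 f"
        using partial geo order_trans by blast
      then show ?thesis by (simp add: S_def)
    qed
    moreover have "0 \<le> 1 / (1 - r) * norm2 f" using r norm2_nonneg by simp
    moreover have "S f \<eta> = 0" if "\<eta> \<notin> I" for \<eta> using off[OF f that] by (simp add: S_def)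
    ultimately show ?thesis using L2_I[of "S f"] by blast
  qed
  have "lp_bounded_op I w 2 S"
    unfolding lp_bounded_op_def
  proof (intro conjI ballI allI exI)
    fix f g assume fg: "f \<in> L2" "g \<in> L2"
    show "S (\<lambda>\<eta>. f \<eta> + g \<eta>) = (\<lambda>\<eta>. S f \<eta> + S g \<eta>)"
      by (rule ext) (simp add: S_def markov_op_pow_add suminf_add[symmetric] summ fg)
  next
    fix f assume "f \<in> L2"
    then show "norm2 (S f) \<le> 1 / (1 - r) * norm2 f" using S_bound by blast
  next
    fix f c assume f: "f \<in> L2"
    show "S (\<lambda>\<eta>. c * f \<eta>) = (\<lambda>\<eta>. c * S f \<eta>)"
      by (rule ext) (simp add: S_def markov_op_pow_cmult suminf_mult summ f)
  qed (use S_bound in auto)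
  moreover have "S (\<lambda>\<eta>. markov_op f \<eta> - 1 * f \<eta>) = f" if f: "f \<in> L2" for f
  proof
    fix \<eta>
    \<comment> \<open>The series for \<open>S\<close> applied to \<open>T f - f\<close> telescopes;
      the boundary term tends to 0 as the general term of a convergent series.\<close>
    have "(\<lambda>n. (markov_op ^^ n) f \<eta> - (markov_op ^^ Suc n) f \<eta>) sums ((markov_op ^^ 0) f \<eta> - 0)"
      by (rule telescope_sums'[OF summable_LIMSEQ_zero[OF summ[OF f]]])
    then have "(\<lambda>n. - ((markov_op ^^ n) f \<eta> - (markov_op ^^ Suc n) f \<eta>)) sums (- f \<eta>)"
      using sums_minus by fastforce
    moreover have "(markov_op ^^ n) (\<lambda>\<eta>. markov_op f \<eta> - 1 * f \<eta>) \<eta> = - ((markov_op ^^ n) f \<eta> - (markov_op ^^ Suc n) f \<eta>)" for n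
      by (simp add: markov_op_pow_diff funpow_swap1)
    ultimately show "S (\<lambda>\<eta>. markov_op f \<eta> - 1 * f \<eta>) \<eta> = f \<eta>"
      by (simp add: S_def sums_iff)
  qed
  moreover have "(\<lambda>\<eta>. markov_op (S f) \<eta> - 1 * S f \<eta>) = f" if f: "f \<in> L2" for f
  proof
    fix \<eta>
    have tail: "(\<Sum>n. (markov_op ^^ n) f \<eta>) = f \<eta> + (\<Sum>n. (markov_op ^^ Suc n) f \<eta>)"
      using suminf_split_head[OF summ[OF f, of \<eta>]] by simp
    have "markov_op (S f) \<eta> = - (\<Sum>n. (markov_op ^^ Suc n) f \<eta>)"
    proof (cases "\<eta> \<in> I")
      case True
      have "markov_op (S f) \<eta> = - (\<Sum>y\<in>nbhd \<eta>. \<Sum>n. (markov_op ^^ n) f y * complex_of_real (p \<eta> y))"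
        using True by (simp add: markov_op_def S_def suminf_mult2[OF summ[OF f]] sum_negf)
      \<comment> \<open>Rows are finite, so the operator commutes with pointwise series and no
        continuity in norm is invoked.\<close>
      also have "(\<Sum>y\<in>nbhd \<eta>. \<Sum>n. (markov_op ^^ n) f y * complex_of_real (p \<eta> y))
          = (\<Sum>n. \<Sum>y\<in>nbhd \<eta>. (markov_op ^^ n) f y * complex_of_real (p \<eta> y))"
        by (intro suminf_sum[symmetric] summable_mult2 summ f)
      finally show ?thesis using True by (simp add: markov_op_def)
    qed (simp add: markov_op_def)
    then show "markov_op (S f) \<eta> - 1 * S f \<eta> = f \<eta>"
      using tail by (simp add: S_def)
  qed
  ultimately show ?thesis by (auto simp: lp_spectrum_def)
qed

lemma isoperimetric_imp_one_not_in_spectrum: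
  assumes lazy: "0 < \<delta>" "\<And>x. x \<in> I \<Longrightarrow> \<delta> \<le> p x x"
    and iso: "0 < \<kappa>" "\<And>G. finite G \<Longrightarrow> G \<subseteq> I \<Longrightarrow>
      \<kappa> * sum w G \<le> (\<Sum>x\<in>G. w x * (1 - (\<Sum>y\<in>G. p x y)))"
  shows "1 \<notin> lp_spectrum I w 2 markov_op"
proof -
  \<comment> \<open>The maximum with 0 makes \<open>sqrt q\<close> a contraction factor whose square
    is \<open>q\<close>, whatever the sizes of \<open>\<delta>\<close> and
    \<open>\<kappa>\<close>.\<close>
  define q where "q = max 0 (1 - \<delta> * \<kappa>\<^sup>2 / 8)"
  have q: "0 \<le> q" "q < 1" "1 - \<delta> * \<kappa>\<^sup>2 / 8 \<le> q"
    using lazy iso(1) by (auto simp: q_def)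
  show ?thesis
    by (rule one_not_in_spectrum[where r = "sqrt q"];
        (rule lp_norm_markov_op_le[where \<delta> = \<delta> and \<kappa> = \<kappa> and r = "sqrt q"])?) (use q lazy iso in auto)
qed

text \<open>An inverse of norm at most \<open>C\<close> would bound the norm of every indicator by
  \<open>C\<close> times the norm of its image under \<open>T - 1\<close>, which is impossible for
  approximate eigenvectors.\<close>

lemma approx_eigenvector_imp_one_in_spectrum:
  assumes approx: "\<And>\<epsilon>. 0 < \<epsilon> \<Longrightarrow> \<exists>F. finite F \<and> F \<subseteq> I \<and>
      (\<lambda>\<eta>. markov_op (indicator F) \<eta> - indicator F \<eta>) \<in> L2 \<and>
      (norm2 (\<lambda>\<eta>. markov_op (indicator F) \<eta> - indicator F \<eta>))\<^sup>2 < \<epsilon> * sum w F"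
  shows "1 \<in> lp_spectrum I w 2 markov_op"
proof (rule ccontr)
  assume "1 \<notin> lp_spectrum I w 2 markov_op"
  then obtain S where S: "lp_bounded_op I w 2 S"
    and inv: "\<And>f. f \<in> L2 \<Longrightarrow> S (\<lambda>\<eta>. markov_op f \<eta> - f \<eta>) = f"
    by (auto simp: lp_spectrum_def)
  from S obtain C where C: "\<And>f. f \<in> L2 \<Longrightarrow> norm2 (S f) \<le> C * norm2 f"
    unfolding lp_bounded_op_def by blast
  \<comment> \<open>The added 1 keeps the tolerance well defined when \<open>C\<close> is 0.\<close>
  obtain F where F: "finite F" "F \<subseteq> I"
    and g: "(\<lambda>\<eta>. markov_op (indicator F) \<eta> - indicator F \<eta>) \<in> L2"
      "(norm2 (\<lambda>\<eta>. markov_op (indicator F) \<eta> - indicator F \<eta>))\<^sup>2 < 1 / (C\<^sup>2 + 1) * sum w F"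
    using approx[of "1 / (C\<^sup>2 + 1)"] by (auto simp: add_nonneg_pos)
  define g where "g = (\<lambda>\<eta>. markov_op (indicator F) \<eta> - indicator F \<eta>)"
  have eq: "cmod (indicator F \<eta>) ^ 2 * w \<eta> = (if \<eta> \<in> F then w \<eta> else 0)" for \<eta>
    by (simp add: indicator_def)
  have "(\<Sum>\<^sub>\<infinity>\<eta>\<in>I. cmod (indicator F \<eta>) ^ 2 * w \<eta>) = infsum w F"
    using F by (intro infsum_cong_neutral) (auto simp: eq)
  then have nF: "norm2 (indicator F) ^ 2 = sum w F"
    using F w_nonneg by (simp add: norm2_eq sum_nonneg subset_iff)
  have "(\<lambda>\<eta>. cmod (indicator F \<eta>) ^ 2 * w \<eta>) summable_on I"
    using F by (intro finite_nonzero_values_imp_summable_on) (auto simp: eq intro: finite_subset)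
  then have "indicator F \<in> L2" using F by (auto simp: lp_space_def indicator_def)
  from inv[OF this] C[of g] have "norm2 (indicator F) \<le> C * norm2 g"
    using g(1) by (simp add: g_def)
  then have "norm2 (indicator F) ^ 2 \<le> (C * norm2 g)\<^sup>2"
    using norm2_nonneg by (intro power_mono)
  also have "\<dots> \<le> (C\<^sup>2 + 1) * (norm2 g)\<^sup>2"
    by (simp add: power_mult_distrib distrib_right)
  also have "\<dots> < (C\<^sup>2 + 1) * (1 / (C\<^sup>2 + 1) * sum w F)"
    using g(2) by (intro mult_strict_left_mono) (auto simp: g_def add_nonneg_pos)
  also have "\<dots> = sum w F"
    using sum_power2_gt_zero_iff[of C 1] by simp
  finally show False using nF by simp
qed

end

section \<open>Fusion coefficients and dimensions\<close>

context fusion_algebra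
begin

abbreviation N :: "'r \<Rightarrow> 'r \<Rightarrow> 'r \<Rightarrow> int"
  where "N \<equiv> fusion_coeff I"

abbreviation dc :: "'r \<Rightarrow> 'r \<Rightarrow> 'r \<Rightarrow> real"
  where "dc \<equiv> dirac_conv I d"

lemma bar_in [simp]: "bar \<xi> \<in> I \<longleftrightarrow> \<xi> \<in> I"
  using bar_basis bar_bar by (metis imageI)

lemma bar_eq_iff [simp]: "bar x = bar y \<longleftrightarrow> x = y"
  using bar_bar by metis

lemma inj_bar: "inj_on bar A"
  by (metis bar_bar inj_on_inverseI)

lemma bar_one: "bar 1 = 1"
proof -
  have "1 = bar (bar 1 * 1)" by (simp add: bar_bar)
  also have "\<dots> = bar 1 * bar (bar 1)" by (rule bar_mult)
  finally show ?thesis by (simp add: bar_bar)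
qed

lemma d_pos: "\<xi> \<in> I \<Longrightarrow> 0 < d \<xi>"
  using dim_ge_1[of \<xi>] by linarith

lemma basis_supp_mult: "basis_supp I (\<xi> * \<eta>) = {\<alpha> \<in> I. N \<xi> \<eta> \<alpha> \<noteq> 0}"
  by (simp add: basis_supp_def fusion_coeff_def)

lemma finite_basis_supp: "finite (basis_supp I r)"
  using int_module.finite_representation[of I r] by (simp add: basis_supp_def)

lemma finite_fusion_coeff: "finite {\<alpha> \<in> I. N \<xi> \<eta> \<alpha> \<noteq> 0}"
  using finite_basis_supp[of "\<xi> * \<eta>"] by (simp add: basis_supp_mult)

lemma fusion_coeff_ge_1:
  "\<lbrakk>\<xi> \<in> I; \<eta> \<in> I; \<alpha> \<in> I; N \<xi> \<eta> \<alpha> \<noteq> 0\<rbrakk> \<Longrightarrow> 1 \<le> N \<xi> \<eta> \<alpha>"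
  using fusion_coeff_nonneg[of \<xi> \<eta> \<alpha>] by linarith

lemma fusion_coeff_bar:
  assumes "\<xi> \<in> I" "\<eta> \<in> I" "\<alpha> \<in> I"
  shows "N (bar \<eta>) (bar \<xi>) (bar \<alpha>) = N \<xi> \<eta> \<alpha>"
proof -
  have "N \<xi> \<eta> \<alpha> = N (bar \<xi>) \<alpha> \<eta>" using assms by (intro frobenius_left)
  also have "\<dots> = N \<eta> (bar \<alpha>) (bar \<xi>)" using assms by (intro frobenius_right) auto
  also have "\<dots> = N (bar \<eta>) (bar \<xi>) (bar \<alpha>)" using assms by (intro frobenius_left) auto
  finally show ?thesis by simp
qed

lemma fusion_coeff_one:
  assumes "\<xi> \<in> I"
  shows "N \<xi> 1 \<xi> = 1" "N 1 \<xi> \<xi> = 1"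
  using int_module.representation_basis[OF basis_independent assms]
  by (simp_all add: fusion_coeff_def)

lemma dim_one: "d 1 = 1"
  using dim_mult[of 1 1] d_pos[OF unit_in_basis] by simp

text \<open>The linear and multiplicative function \<open>d\<close> is applied to the expansion of
  \<open>\<xi> * \<eta>\<close> in the basis. This identity is what gives the convolution of two
  Dirac measures total mass 1.\<close>

lemma sum_fusion_coeff_dim:
  "(\<Sum>\<alpha> | \<alpha> \<in> I \<and> N \<xi> \<eta> \<alpha> \<noteq> 0. of_int (N \<xi> \<eta> \<alpha>) * d \<alpha>) = d \<xi> * d \<eta>"
proof -
  interpret d: module_hom int_scale int_scale d by (rule dim_linear)
  have eq: "{\<alpha>. N \<xi> \<eta> \<alpha> \<noteq> 0} = {\<alpha> \<in> I. N \<xi> \<eta> \<alpha> \<noteq> 0}"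
    using int_module.representation_ne_zero[of I "\<xi> * \<eta>"] by (auto simp: fusion_coeff_def)
  have "\<xi> * \<eta> = (\<Sum>\<alpha> | N \<xi> \<eta> \<alpha> \<noteq> 0. of_int (N \<xi> \<eta> \<alpha>) * \<alpha>)"
    using int_module.sum_nonzero_representation_eq[OF basis_independent, of "\<xi> * \<eta>"]
    by (simp add: basis_span fusion_coeff_def)
  then have "d (\<xi> * \<eta>) = (\<Sum>\<alpha> | N \<xi> \<eta> \<alpha> \<noteq> 0. of_int (N \<xi> \<eta> \<alpha>) * d \<alpha>)"
    by (simp only: d.sum d.scale)
  then show ?thesis by (simp add: dim_mult eq)
qed

lemma dim_le_of_fusion_coeff:
  assumes "\<xi> \<in> I" "\<eta> \<in> I" "\<alpha> \<in> I" "N \<xi> \<eta> \<alpha> \<noteq> 0"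
  shows "d \<alpha> \<le> d \<xi> * d \<eta>"
proof -
  have "d \<alpha> \<le> of_int (N \<xi> \<eta> \<alpha>) * d \<alpha>"
    using fusion_coeff_ge_1[OF assms] d_pos[OF assms(3)] by simp
  also have "\<dots> \<le> (\<Sum>\<alpha> | \<alpha> \<in> I \<and> N \<xi> \<eta> \<alpha> \<noteq> 0. of_int (N \<xi> \<eta> \<alpha>) * d \<alpha>)"
    using assms finite_fusion_coeff d_pos fusion_coeff_nonneg
    by (intro member_le_sum) (auto simp: less_imp_le)
  finally show ?thesis by (simp add: sum_fusion_coeff_dim)
qed

text \<open>For a constituent \<open>\<alpha>\<close>, one factor \<open>d \<alpha>\<close> is
  bounded by \<open>d \<xi> * d \<eta>\<close> and the other by its share
  \<open>N \<xi> \<eta> \<alpha> * d \<alpha>\<close>; these shares add up to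
  \<open>d \<xi> * d \<eta>\<close>.\<close>

lemma dim_sq_basis_supp_le:
  assumes "\<xi> \<in> I" "\<eta> \<in> I"
  shows "(\<Sum>\<alpha>\<in>basis_supp I (\<xi> * \<eta>). (d \<alpha>)\<^sup>2) \<le> (d \<xi>)\<^sup>2 * (d \<eta>)\<^sup>2"
proof -
  have "(\<Sum>\<alpha>\<in>basis_supp I (\<xi> * \<eta>). (d \<alpha>)\<^sup>2)
      \<le> (\<Sum>\<alpha>\<in>basis_supp I (\<xi> * \<eta>). (of_int (N \<xi> \<eta> \<alpha>) * d \<alpha>) * (d \<xi> * d \<eta>))"
  proof (rule sum_mono)
    fix \<alpha> assume "\<alpha> \<in> basis_supp I (\<xi> * \<eta>)"
    then have a: "\<alpha> \<in> I" "N \<xi> \<eta> \<alpha> \<noteq> 0" by (auto simp: basis_supp_mult)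
    have "d \<alpha> \<le> of_int (N \<xi> \<eta> \<alpha>) * d \<alpha>"
      using fusion_coeff_ge_1[OF assms a] d_pos[OF a(1)] by simp
    moreover note dim_le_of_fusion_coeff[OF assms a]
    ultimately show "(d \<alpha>)\<^sup>2 \<le> (of_int (N \<xi> \<eta> \<alpha>) * d \<alpha>) * (d \<xi> * d \<eta>)"
      unfolding power2_eq_square using d_pos[OF a(1)] by (intro mult_mono) auto
  qed
  also have "\<dots> = (d \<xi>)\<^sup>2 * (d \<eta>)\<^sup>2"
    by (simp add: sum_distrib_right[symmetric] basis_supp_mult sum_fusion_coeff_dim power2_eq_square)
  finally show ?thesis .
qed

lemma dirac_conv_nonneg:
  "\<lbrakk>\<xi> \<in> I; \<eta> \<in> I; \<alpha> \<in> I\<rbrakk> \<Longrightarrow> 0 \<le> dc \<xi> \<eta> \<alpha>"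
  using d_pos fusion_coeff_nonneg by (simp add: dirac_conv_def less_imp_le)

lemma dirac_conv_eq_0_iff:
  "\<lbrakk>\<xi> \<in> I; \<eta> \<in> I; \<alpha> \<in> I\<rbrakk> \<Longrightarrow> dc \<xi> \<eta> \<alpha> = 0 \<longleftrightarrow> N \<xi> \<eta> \<alpha> = 0"
  using d_pos[of \<xi>] d_pos[of \<eta>] d_pos[of \<alpha>] by (simp add: dirac_conv_def)

lemma finite_dirac_conv: "finite {\<alpha> \<in> I. dc \<xi> \<eta> \<alpha> \<noteq> 0}"
  by (rule finite_subset[OF _ finite_fusion_coeff[of \<xi> \<eta>]]) (auto simp: dirac_conv_def)

lemma sum_dirac_conv:
  assumes "\<xi> \<in> I" "\<eta> \<in> I" "finite H" "H \<subseteq> I" "\<And>\<alpha>. \<alpha> \<in> I - H \<Longrightarrow> dc \<xi> \<eta> \<alpha> = 0"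
  shows "(\<Sum>\<alpha>\<in>H. dc \<xi> \<eta> \<alpha>) = 1"
proof -
  have "(\<Sum>\<alpha>\<in>H. dc \<xi> \<eta> \<alpha>) = (\<Sum>\<alpha> | \<alpha> \<in> I \<and> N \<xi> \<eta> \<alpha> \<noteq> 0. dc \<xi> \<eta> \<alpha>)"
    using assms by (intro sum.mono_neutral_right) (auto simp: dirac_conv_eq_0_iff)
  also have "\<dots> = (\<Sum>\<alpha> | \<alpha> \<in> I \<and> N \<xi> \<eta> \<alpha> \<noteq> 0. of_int (N \<xi> \<eta> \<alpha>) * d \<alpha>) / (d \<xi> * d \<eta>)"
    by (simp add: dirac_conv_def sum_divide_distrib mult.commute)
  also have "\<dots> = 1"
    using d_pos[of \<xi>] d_pos[of \<eta>] assms by (simp add: sum_fusion_coeff_dim)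
  finally show ?thesis .
qed

text \<open>By Frobenius reciprocity \<open>\<eta>\<close> is a constituent of
  \<open>bar \<xi> * \<alpha>\<close>, so \<open>d \<eta>\<close> is at most
  \<open>d \<xi> * d \<alpha>\<close>. The resulting bound is uniform in \<open>\<eta>\<close> and
  \<open>\<alpha>\<close>.\<close>

lemma dirac_conv_ge:
  assumes "\<xi> \<in> I" "\<eta> \<in> I" "\<alpha> \<in> I" "N \<xi> \<eta> \<alpha> \<noteq> 0"
  shows "1 / (d \<xi>)\<^sup>2 \<le> dc \<xi> \<eta> \<alpha>"
proof -
  have "N (bar \<xi>) \<alpha> \<eta> \<noteq> 0" using assms frobenius_left[of \<xi> \<eta> \<alpha>] by simp
  then have "d \<eta> \<le> d \<xi> * d \<alpha>"
    using dim_le_of_fusion_coeff[of "bar \<xi>" \<alpha> \<eta>] assms dim_bar by simp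
  then have "1 / (d \<xi>)\<^sup>2 \<le> d \<alpha> / (d \<xi> * d \<eta>)"
    using d_pos[OF assms(1)] d_pos[OF assms(2)] by (simp add: divide_simps power2_eq_square mult.commute)
  also have "\<dots> * 1 \<le> d \<alpha> / (d \<xi> * d \<eta>) * of_int (N \<xi> \<eta> \<alpha>)"
    using fusion_coeff_ge_1[OF assms] d_pos assms by (intro mult_left_mono) (auto simp: less_imp_le)
  finally show ?thesis by (simp add: dirac_conv_def)
qed

lemma dirac_conv_bar:
  assumes "\<xi> \<in> I" "\<eta> \<in> I" "\<alpha> \<in> I"
  shows "dc (bar \<eta>) (bar \<xi>) (bar \<alpha>) = dc \<xi> \<eta> \<alpha>"
  using assms by (simp add: dirac_conv_def fusion_coeff_bar dim_bar mult.commute)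

text \<open>Both sides equal \<open>d \<eta> * d \<alpha> / d \<xi>\<close> times one fusion
  coefficient, by Frobenius reciprocity. This is the detailed balance behind the weight
  \<open>dim_measure d\<close>.\<close>

lemma dirac_conv_reversible:
  assumes "\<xi> \<in> I" "\<eta> \<in> I" "\<alpha> \<in> I"
  shows "(d \<eta>)\<^sup>2 * dc (bar \<xi>) \<eta> \<alpha> = (d \<alpha>)\<^sup>2 * dc \<xi> \<alpha> \<eta>"
  using assms frobenius_left[of \<xi> \<alpha> \<eta>] d_pos[of \<xi>] d_pos[of \<eta>] d_pos[of \<alpha>]
  by (simp add: dirac_conv_def dim_bar field_simps power2_eq_square)

end

section \<open>The random walk of a symmetric measure\<close>

locale symmetric_walk = fusion_algebra I bar d
  for I :: "'r::ring_1 set" and bar :: "'r \<Rightarrow> 'r" and d :: "'r \<Rightarrow> real" +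
  fixes \<mu> :: "'r pmf"
  assumes symm: "fin_symm_prob I bar \<mu>"
begin

text \<open>The kernel of \<open>\<lambda>\<^sub>\<mu>\<close>.\<close>

definition walk :: "'r \<Rightarrow> 'r \<Rightarrow> real"
  where "walk \<eta> \<alpha> = (\<Sum>\<xi>\<in>set_pmf \<mu>. pmf \<mu> \<xi> * dc (bar \<xi>) \<eta> \<alpha>)"

lemma supp_subset: "\<xi> \<in> set_pmf \<mu> \<Longrightarrow> \<xi> \<in> I"
  and finite_supp: "finite (set_pmf \<mu>)"
  and pmf_bar: "\<xi> \<in> I \<Longrightarrow> pmf \<mu> (bar \<xi>) = pmf \<mu> \<xi>"
  using symm by (auto simp: fin_symm_prob_def)

lemma bar_in_supp: "\<xi> \<in> set_pmf \<mu> \<Longrightarrow> bar \<xi> \<in> set_pmf \<mu>"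
  using pmf_bar[of \<xi>] supp_subset[of \<xi>] by (simp add: set_pmf_iff)

lemma bar_supp: "bar ` set_pmf \<mu> = set_pmf \<mu>"
proof
  show "set_pmf \<mu> \<subseteq> bar ` set_pmf \<mu>"
  proof
    fix x assume "x \<in> set_pmf \<mu>"
    then show "x \<in> bar ` set_pmf \<mu>" using bar_in_supp bar_bar by (metis imageI)
  qed
qed (auto intro: bar_in_supp)

lemma sum_pmf_supp: "(\<Sum>\<xi>\<in>set_pmf \<mu>. pmf \<mu> \<xi>) = 1"
  using finite_supp by (intro sum_pmf_eq_1) auto

lemma fun_supp_pmf: "fun_supp I (pmf \<mu>) = set_pmf \<mu>"
  using supp_subset by (auto simp: fun_supp_def set_pmf_iff)

text \<open>Symmetry of \<open>\<mu>\<close> allows the involution to be dropped. Reversibility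
  compares this form of the kernel with the defining one.\<close>

lemma walk_eq: "walk \<eta> \<alpha> = (\<Sum>\<xi>\<in>set_pmf \<mu>. pmf \<mu> \<xi> * dc \<xi> \<eta> \<alpha>)"
proof -
  have "walk \<eta> \<alpha> = (\<Sum>\<xi>\<in>bar ` set_pmf \<mu>. pmf \<mu> \<xi> * dc \<xi> \<eta> \<alpha>)"
    using supp_subset by (subst sum.reindex[OF inj_bar]) (auto simp: walk_def pmf_bar intro!: sum.cong)
  then show ?thesis by (simp add: bar_supp)
qed

lemma walk_ge:
  assumes "\<xi> \<in> set_pmf \<mu>" "\<eta> \<in> I" "\<alpha> \<in> I"
  shows "pmf \<mu> \<xi> * dc \<xi> \<eta> \<alpha> \<le> walk \<eta> \<alpha>"
  unfolding walk_eq using assms finite_supp supp_subset dirac_conv_nonneg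
  by (intro member_le_sum) auto

sublocale markov_kernel I "dim_measure d" walk
proof
  fix x assume x: "x \<in> I"
  show "1 \<le> dim_measure d x"
    using dim_ge_1[OF x] by (simp add: dim_measure_def)
  have sub: "{y \<in> I. walk x y \<noteq> 0} \<subseteq> (\<Union>\<xi>\<in>set_pmf \<mu>. {y \<in> I. dc \<xi> x y \<noteq> 0})"
  proof
    fix y assume y: "y \<in> {y \<in> I. walk x y \<noteq> 0}"
    then have "(\<Sum>\<xi>\<in>set_pmf \<mu>. pmf \<mu> \<xi> * dc \<xi> x y) \<noteq> 0" by (simp add: walk_eq)
    then obtain \<xi> where "\<xi> \<in> set_pmf \<mu>" "pmf \<mu> \<xi> * dc \<xi> x y \<noteq> 0"
      by (rule sum.not_neutral_contains_not_neutral)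
    with y show "y \<in> (\<Union>\<xi>\<in>set_pmf \<mu>. {y \<in> I. dc \<xi> x y \<noteq> 0})" by auto
  qed
  have fin: "finite (\<Union>\<xi>\<in>set_pmf \<mu>. {y \<in> I. dc \<xi> x y \<noteq> 0})"
    using finite_supp finite_dirac_conv by blast
  show "finite {y \<in> I. walk x y \<noteq> 0}" using sub fin by (rule finite_subset)
  \<comment> \<open>One finite set supporting the rows of all \<open>\<xi>\<close> at once, so that
    the two sums can be interchanged.\<close>
  let ?H = "\<Union>\<xi>\<in>set_pmf \<mu>. {y \<in> I. dc \<xi> x y \<noteq> 0}"
  have "(\<Sum>y | y \<in> I \<and> walk x y \<noteq> 0. walk x y) = (\<Sum>y\<in>?H. walk x y)"
    using sub fin by (intro sum.mono_neutral_left) auto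
  also have "\<dots> = (\<Sum>\<xi>\<in>set_pmf \<mu>. pmf \<mu> \<xi> * (\<Sum>y\<in>?H. dc \<xi> x y))"
    unfolding walk_eq by (subst sum.swap) (simp add: sum_distrib_left)
  also have "\<dots> = (\<Sum>\<xi>\<in>set_pmf \<mu>. pmf \<mu> \<xi> * 1)"
  proof (intro sum.cong refl)
    fix \<xi> assume "\<xi> \<in> set_pmf \<mu>"
    then have "(\<Sum>y\<in>?H. dc \<xi> x y) = 1"
      using fin x supp_subset by (intro sum_dirac_conv) auto
    then show "pmf \<mu> \<xi> * (\<Sum>y\<in>?H. dc \<xi> x y) = pmf \<mu> \<xi> * 1" by simp
  qed
  finally show "(\<Sum>y | y \<in> I \<and> walk x y \<noteq> 0. walk x y) = 1" by (simp add: sum_pmf_supp)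
next
  fix x y assume "x \<in> I" "y \<in> I"
  then show "0 \<le> walk x y"
    unfolding walk_eq using supp_subset dirac_conv_nonneg by (intro sum_nonneg) auto
next
  fix x y assume xy: "x \<in> I" "y \<in> I"
  have "dim_measure d x * walk x y = (\<Sum>\<xi>\<in>set_pmf \<mu>. pmf \<mu> \<xi> * ((d x)\<^sup>2 * dc (bar \<xi>) x y))"
    by (simp add: walk_def dim_measure_def sum_distrib_left mult_ac)
  also have "\<dots> = (\<Sum>\<xi>\<in>set_pmf \<mu>. pmf \<mu> \<xi> * ((d y)\<^sup>2 * dc \<xi> y x))"
    using xy supp_subset by (intro sum.cong refl) (simp add: dirac_conv_reversible)
  also have "\<dots> = dim_measure d y * walk y x"
    by (simp add: walk_eq dim_measure_def sum_distrib_left mult_ac)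
  finally show "dim_measure d x * walk x y = dim_measure d y * walk y x" .
qed

end

section \<open>Convolution operators and boundaries\<close>

context fusion_algebra
begin

lemma infsum_dirac_conv:
  assumes "finite H" "H \<subseteq> I" "\<And>\<alpha>. \<alpha> \<in> I - H \<Longrightarrow> f \<alpha> * complex_of_real (dc \<xi> \<eta> \<alpha>) = 0"
  shows "(\<Sum>\<^sub>\<infinity>\<alpha>\<in>I. f \<alpha> * complex_of_real (dc \<xi> \<eta> \<alpha>)) = (\<Sum>\<alpha>\<in>H. f \<alpha> * complex_of_real (dc \<xi> \<eta> \<alpha>))"
proof -
  have "(\<Sum>\<^sub>\<infinity>\<alpha>\<in>I. f \<alpha> * complex_of_real (dc \<xi> \<eta> \<alpha>)) = (\<Sum>\<^sub>\<infinity>\<alpha>\<in>H. f \<alpha> * complex_of_real (dc \<xi> \<eta> \<alpha>))"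
    using assms by (intro infsum_cong_neutral) auto
  with assms show ?thesis by simp
qed

text \<open>The value at \<open>\<eta>\<close> of the right convolution operator minus the identity,
  applied to the indicator of a finite \<open>F\<close>, as a real number and a finite sum.\<close>

definition indicator_defect :: "'r set \<Rightarrow> 'r \<Rightarrow> 'r \<Rightarrow> real"
  where "indicator_defect F \<xi> \<eta> = (\<Sum>\<alpha>\<in>F. dc \<eta> \<xi> \<alpha>) - indicator F \<eta>"

lemma right_op_indicator:
  assumes "finite F" "F \<subseteq> I" "\<eta> \<in> I"
  shows "right_op I d \<xi> (indicator F) \<eta> - indicator F \<eta> = complex_of_real (indicator_defect F \<xi> \<eta>)"
proof -
  have "right_op I d \<xi> (indicator F) \<eta> = (\<Sum>\<alpha>\<in>F. indicator F \<alpha> * complex_of_real (dc \<eta> \<xi> \<alpha>))"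
    using assms infsum_dirac_conv[of F "indicator F" \<eta> \<xi>] by (simp add: right_op_def)
  also have "\<dots> = complex_of_real (\<Sum>\<alpha>\<in>F. dc \<eta> \<xi> \<alpha>)"
    unfolding of_real_sum by (intro sum.cong) auto
  finally show ?thesis by (simp add: indicator_defect_def indicator_def)
qed

text \<open>The involution reverses convolutions, so it carries the right operators of the Folner
  conditions to the left operators in the definition of amenability.\<close>

lemma left_op_indicator_bar:
  assumes "F \<subseteq> I" "\<xi> \<in> I" "\<eta> \<in> I"
  shows "left_op I bar d \<xi> (indicator (bar ` F)) (bar \<eta>) = right_op I d \<xi> (indicator F) \<eta>"
proof -
  have "bij_betw bar I I" using inj_bar bar_basis by (auto simp: bij_betw_def)
  then have "(\<Sum>\<^sub>\<infinity>\<alpha>\<in>I. indicator (bar ` F) \<alpha> * complex_of_real (dc (bar \<xi>) (bar \<eta>) \<alpha>))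
      = (\<Sum>\<^sub>\<infinity>\<alpha>\<in>I. indicator (bar ` F) (bar \<alpha>) * complex_of_real (dc (bar \<xi>) (bar \<eta>) (bar \<alpha>)))"
    using infsum_reindex_bij_betw[of bar I I
      "\<lambda>\<alpha>. indicator (bar ` F) \<alpha> * complex_of_real (dc (bar \<xi>) (bar \<eta>) \<alpha>)"] by simp
  also have "\<dots> = (\<Sum>\<^sub>\<infinity>\<alpha>\<in>I. indicator F \<alpha> * complex_of_real (dc \<eta> \<xi> \<alpha>))"
  proof (rule infsum_cong)
    fix \<alpha> assume "\<alpha> \<in> I"
    moreover have "bar \<alpha> \<in> bar ` F \<longleftrightarrow> \<alpha> \<in> F" by (rule inj_image_mem_iff[OF inj_bar])
    ultimately show "indicator (bar ` F) (bar \<alpha>) * complex_of_real (dc (bar \<xi>) (bar \<eta>) (bar \<alpha>))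
        = indicator F \<alpha> * complex_of_real (dc \<eta> \<xi> \<alpha>)"
      using assms by (simp add: dirac_conv_bar indicator_def)
  qed
  finally show ?thesis using assms by (simp add: left_op_def right_op_def)
qed

lemma abs_indicator_defect_le:
  assumes "finite F" "F \<subseteq> I" "\<xi> \<in> I" "\<eta> \<in> I"
  shows "\<bar>indicator_defect F \<xi> \<eta>\<bar> \<le> 1"
proof -
  let ?H = "F \<union> {\<alpha> \<in> I. dc \<eta> \<xi> \<alpha> \<noteq> 0}"
  have "(\<Sum>\<alpha>\<in>F. dc \<eta> \<xi> \<alpha>) \<le> (\<Sum>\<alpha>\<in>?H. dc \<eta> \<xi> \<alpha>)"
    using assms finite_dirac_conv dirac_conv_nonneg by (intro sum_mono2) auto
  also have "\<dots> = 1" using assms finite_dirac_conv by (intro sum_dirac_conv) auto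
  finally have "(\<Sum>\<alpha>\<in>F. dc \<eta> \<xi> \<alpha>) \<le> 1" .
  moreover have "0 \<le> (\<Sum>\<alpha>\<in>F. dc \<eta> \<xi> \<alpha>)"
    using assms dirac_conv_nonneg by (intro sum_nonneg) auto
  ultimately show ?thesis by (auto simp: indicator_defect_def indicator_def)
qed

text \<open>Frobenius reciprocity: \<open>\<beta>\<close> occurs in \<open>\<alpha> * \<xi>\<close>
  exactly when \<open>\<alpha>\<close> occurs in \<open>\<beta> * bar \<xi>\<close>. Thus the outer
  part of the boundary, which ranges over all of \<open>I - F\<close>, is confined to neighbours of
  \<open>F\<close>.\<close>

lemma outer_boundary_neighbour:
  assumes "\<alpha> \<in> I" "\<xi> \<in> I" "\<not> basis_supp I (\<alpha> * \<xi>) \<subseteq> I - F"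
  obtains \<beta> where "\<beta> \<in> F" "\<beta> \<in> I" "\<alpha> \<in> basis_supp I (\<beta> * bar \<xi>)"
proof -
  from assms(3) obtain \<beta> where b: "\<beta> \<in> F" "\<beta> \<in> I" "N \<alpha> \<xi> \<beta> \<noteq> 0"
    by (auto simp: basis_supp_mult)
  with assms have "\<alpha> \<in> basis_supp I (\<beta> * bar \<xi>)"
    using frobenius_right[of \<alpha> \<xi> \<beta>] by (simp add: basis_supp_mult)
  with b that show ?thesis by blast
qed

lemma finite_boundary:
  assumes "finite S" "S \<subseteq> I" "finite F"
  shows "finite (boundary I S F)"
proof (rule finite_subset)
  show "boundary I S F \<subseteq> F \<union> (\<Union>\<xi>\<in>S. \<Union>\<beta>\<in>F. basis_supp I (\<beta> * bar \<xi>))"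
  proof
    fix \<alpha> assume "\<alpha> \<in> boundary I S F"
    then consider "\<alpha> \<in> F"
      | \<xi> where "\<alpha> \<in> I" "\<xi> \<in> S" "\<not> basis_supp I (\<alpha> * \<xi>) \<subseteq> I - F"
      by (auto simp: boundary_def)
    then show "\<alpha> \<in> F \<union> (\<Union>\<xi>\<in>S. \<Union>\<beta>\<in>F. basis_supp I (\<beta> * bar \<xi>))"
    proof cases
      case (2 \<xi>)
      then show ?thesis using assms outer_boundary_neighbour[of \<alpha> \<xi> F] by blast
    qed simp
  qed
  show "finite (F \<union> (\<Union>\<xi>\<in>S. \<Union>\<beta>\<in>F. basis_supp I (\<beta> * bar \<xi>)))"
    using assms finite_basis_supp by auto
qed

lemma boundary_subset: "F \<subseteq> I \<Longrightarrow> boundary I S F \<subseteq> I"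
  by (auto simp: boundary_def)

text \<open>Off the boundary the probability measure with density \<open>dc \<eta> \<xi>\<close>
  lives entirely on the same side of \<open>F\<close> as \<open>\<eta>\<close>.\<close>

lemma indicator_defect_eq_0:
  assumes "finite F" "F \<subseteq> I" "\<xi> \<in> S" "S \<subseteq> I" "\<eta> \<in> I" "\<eta> \<notin> boundary I S F"
  shows "indicator_defect F \<xi> \<eta> = 0"
proof (cases "\<eta> \<in> F")
  case True
  with assms have "basis_supp I (\<eta> * \<xi>) \<subseteq> F" by (auto simp: boundary_def)
  then have "(\<Sum>\<alpha>\<in>F. dc \<eta> \<xi> \<alpha>) = 1"
    using assms by (intro sum_dirac_conv) (auto simp: basis_supp_mult dirac_conv_def)
  with True show ?thesis by (simp add: indicator_defect_def)
next
  case False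
  with assms have "basis_supp I (\<eta> * \<xi>) \<subseteq> I - F" by (auto simp: boundary_def)
  then have "dc \<eta> \<xi> \<alpha> = 0" if "\<alpha> \<in> F" for \<alpha>
    using assms that by (auto simp: basis_supp_mult dirac_conv_def)
  with False show ?thesis by (simp add: indicator_defect_def)
qed

lemma lp_norm_1_right_op:
  assumes "finite F" "F \<subseteq> I" "\<xi> \<in> S" "S \<subseteq> I" "finite S"
  shows "lp_norm I (dim_measure d) 1 (\<lambda>\<eta>. right_op I d \<xi> (indicator F) \<eta> - indicator F \<eta>)
    = (\<Sum>\<eta>\<in>boundary I S F. \<bar>indicator_defect F \<xi> \<eta>\<bar> * (d \<eta>)\<^sup>2)"
proof -
  have "(\<Sum>\<^sub>\<infinity>\<eta>\<in>I. cmod (right_op I d \<xi> (indicator F) \<eta> - indicator F \<eta>) ^ 1 * dim_measure d \<eta>)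
      = (\<Sum>\<^sub>\<infinity>\<eta>\<in>boundary I S F. \<bar>indicator_defect F \<xi> \<eta>\<bar> * (d \<eta>)\<^sup>2)"
    using assms boundary_subset[of F S]
    by (intro infsum_cong_neutral)
      (auto simp: right_op_indicator indicator_defect_eq_0[where S = S] dim_measure_def)
  also have "\<dots> = (\<Sum>\<eta>\<in>boundary I S F. \<bar>indicator_defect F \<xi> \<eta>\<bar> * (d \<eta>)\<^sup>2)"
    using assms by (simp add: finite_boundary)
  finally show ?thesis by (simp add: lp_norm_def)
qed

lemma lp_norm_1_indicator:
  assumes "finite F" "F \<subseteq> I"
  shows "lp_norm I (dim_measure d) 1 (indicator F) = (\<Sum>\<eta>\<in>F. (d \<eta>)\<^sup>2)"
proof -
  have "(\<Sum>\<^sub>\<infinity>\<eta>\<in>I. cmod (indicator F \<eta>) ^ 1 * dim_measure d \<eta>) = (\<Sum>\<^sub>\<infinity>\<eta>\<in>F. (d \<eta>)\<^sup>2)"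
    using assms by (intro infsum_cong_neutral) (auto simp: dim_measure_def)
  with assms show ?thesis by (simp add: lp_norm_def)
qed

lemma FC3_imp_FC2:
  assumes "folner_FC3 I d"
  shows "folner_FC2 I d"
  unfolding folner_FC2_def
proof (intro allI impI, elim conjE)
  fix S and \<epsilon> :: real assume S: "finite S" "S \<noteq> {}" "S \<subseteq> I" "\<epsilon> > 0"
  then obtain F where F: "finite F" "F \<subseteq> I"
    "(\<Sum>\<xi>\<in>boundary I S F. (d \<xi>)\<^sup>2) < \<epsilon> * (\<Sum>\<xi>\<in>F. (d \<xi>)\<^sup>2)"
    using assms[unfolded folner_FC3_def, rule_format, of S \<epsilon>] by auto
  have "lp_norm I (dim_measure d) 1 (\<lambda>\<eta>. right_op I d \<xi> (indicator F) \<eta> - indicator F \<eta>)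
      < \<epsilon> * lp_norm I (dim_measure d) 1 (indicator F)" if "\<xi> \<in> S" for \<xi>
  proof -
    have "(\<Sum>\<eta>\<in>boundary I S F. \<bar>indicator_defect F \<xi> \<eta>\<bar> * (d \<eta>)\<^sup>2) \<le> (\<Sum>\<eta>\<in>boundary I S F. 1 * (d \<eta>)\<^sup>2)"
      using that S F boundary_subset[of F S]
      by (intro sum_mono mult_right_mono abs_indicator_defect_le) auto
    then show ?thesis
      using that S F lp_norm_1_right_op[of F \<xi> S] lp_norm_1_indicator[of F] by simp
  qed
  with F show "\<exists>F. finite F \<and> F \<subseteq> I \<and> (\<forall>\<xi>\<in>S.
      lp_norm I (dim_measure d) 1 (\<lambda>\<eta>. right_op I d \<xi> (indicator F) \<eta> - indicator F \<eta>)
      < \<epsilon> * lp_norm I (dim_measure d) 1 (indicator F))"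
    by blast
qed

end

section \<open>Approximate eigenvectors of the walk\<close>

context symmetric_walk
begin

lemma left_op_measure_eq: "left_op_measure I bar d (pmf \<mu>) = markov_op"
proof (intro ext)
  fix f \<eta>
  show "left_op_measure I bar d (pmf \<mu>) f \<eta> = markov_op f \<eta>"
  proof (cases "\<eta> \<in> I")
    case True
    \<comment> \<open>A common finite index set for all the infinite sums and for the row of the
      walk.\<close>
    define H where "H = nbhd \<eta> \<union> (\<Union>\<xi>\<in>set_pmf \<mu>. {\<alpha> \<in> I. dc (bar \<xi>) \<eta> \<alpha> \<noteq> 0})"
    have H: "finite H" "H \<subseteq> I" "nbhd \<eta> \<subseteq> H"
      using True finite_nbhd nbhd_subset finite_supp finite_dirac_conv by (auto simp: H_def)
    have "left_op_measure I bar d (pmf \<mu>) f \<eta>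
        = (\<Sum>\<xi>\<in>set_pmf \<mu>. complex_of_real (pmf \<mu> \<xi>) * (\<Sum>\<alpha>\<in>H. f \<alpha> * complex_of_real (dc (bar \<xi>) \<eta> \<alpha>)))"
      unfolding left_op_measure_def fun_supp_pmf
    proof (intro sum.cong refl arg_cong2[where f = "(*)"])
      fix \<xi> assume x: "\<xi> \<in> set_pmf \<mu>"
      show "left_op I bar d \<xi> f \<eta> = (\<Sum>\<alpha>\<in>H. f \<alpha> * complex_of_real (dc (bar \<xi>) \<eta> \<alpha>))"
        unfolding left_op_def using True H(1,2) x by (auto simp: H_def intro!: infsum_dirac_conv)
    qed
    also have "\<dots> = (\<Sum>\<alpha>\<in>H. f \<alpha> * complex_of_real (walk \<eta> \<alpha>))"
      unfolding walk_def sum_distrib_left of_real_sum by (subst sum.swap) (simp add: mult_ac)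
    also have "\<dots> = markov_op f \<eta>" using markov_op_eq[OF H] True by simp
    finally show ?thesis .
  qed (simp add: left_op_measure_def left_op_def markov_op_def)
qed

text \<open>The approximate eigenvector is the indicator of the image of \<open>F\<close> under
  \<open>bar\<close>, since the walk acts from the left. Smallness in the 1-norm passes to the
  2-norm because the defects are bounded by 1.\<close>

lemma FC2_imp_one_in_spectrum:
  assumes "folner_FC2 I d"
  shows "1 \<in> lp_spectrum I (dim_measure d) 2 markov_op"
proof (rule approx_eigenvector_imp_one_in_spectrum)
  fix \<epsilon> :: real assume "0 < \<epsilon>"
  let ?S = "set_pmf \<mu>"
  have S: "finite ?S" "?S \<noteq> {}" "?S \<subseteq> I" using finite_supp supp_subset set_pmf_not_empty by auto
  then obtain F where F: "finite F" "F \<subseteq> I"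
    and approx: "\<And>\<xi>. \<xi> \<in> ?S \<Longrightarrow>
      lp_norm I (dim_measure d) 1 (\<lambda>\<eta>. right_op I d \<xi> (indicator F) \<eta> - indicator F \<eta>)
      < \<epsilon> * lp_norm I (dim_measure d) 1 (indicator F)"
    using assms[unfolded folner_FC2_def, rule_format, of ?S \<epsilon>] \<open>0 < \<epsilon>\<close> by auto
  let ?B = "boundary I ?S F"
  have B: "finite ?B" "?B \<subseteq> I" using finite_boundary boundary_subset S F by auto
  define g where "g = (\<lambda>\<eta>. markov_op (indicator (bar ` F)) \<eta> - indicator (bar ` F) \<eta>)"
  define m where "m \<eta> = (\<Sum>\<xi>\<in>?S. pmf \<mu> \<xi> * indicator_defect F \<xi> \<eta>)" for \<eta>
  have g_bar: "g (bar \<eta>) = complex_of_real (m \<eta>)" if "\<eta> \<in> I" for \<eta>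
  proof -
    have "markov_op (indicator (bar ` F)) (bar \<eta>)
        = (\<Sum>\<xi>\<in>?S. complex_of_real (pmf \<mu> \<xi>) * left_op I bar d \<xi> (indicator (bar ` F)) (bar \<eta>))"
      unfolding left_op_measure_eq[symmetric] by (simp add: left_op_measure_def fun_supp_pmf)
    also have "\<dots> = (\<Sum>\<xi>\<in>?S. complex_of_real (pmf \<mu> \<xi>) * right_op I d \<xi> (indicator F) \<eta>)"
      using that F S by (intro sum.cong refl) (auto simp: left_op_indicator_bar)
    also have "\<dots> = (\<Sum>\<xi>\<in>?S. complex_of_real (pmf \<mu> \<xi> * indicator_defect F \<xi> \<eta>)
        + complex_of_real (pmf \<mu> \<xi>) * indicator F \<eta>)"
      using that F by (intro sum.cong refl) (simp add: right_op_indicator[symmetric] right_diff_distrib)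
    also have "\<dots> = complex_of_real (m \<eta>) + complex_of_real (\<Sum>\<xi>\<in>?S. pmf \<mu> \<xi>) * indicator F \<eta>"
      by (simp add: sum.distrib m_def sum_distrib_right)
    also have "indicator F \<eta> = (indicator (bar ` F) (bar \<eta>) :: complex)"
      by (simp add: indicator_def inj_image_mem_iff[OF inj_bar])
    finally show ?thesis by (simp add: g_def sum_pmf_supp)
  qed
  have m_0: "m \<eta> = 0" if "\<eta> \<in> I" "\<eta> \<notin> ?B" for \<eta>
    using that F S indicator_defect_eq_0[of F _ ?S \<eta>] by (simp add: m_def)
  \<comment> \<open>The \<open>\<mu>\<close>-average of the 1-norms controlled by (FC2). All sums
    run over the one finite boundary \<open>?B\<close>, outside which every defect vanishes.\<close>
  define X where "X = (\<Sum>\<eta>\<in>?B. \<Sum>\<xi>\<in>?S. pmf \<mu> \<xi> * (\<bar>indicator_defect F \<xi> \<eta>\<bar> * (d \<eta>)\<^sup>2))"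
  have m_sq: "(m \<eta>)\<^sup>2 * (d \<eta>)\<^sup>2 \<le> (\<Sum>\<xi>\<in>?S. pmf \<mu> \<xi> * (\<bar>indicator_defect F \<xi> \<eta>\<bar> * (d \<eta>)\<^sup>2))"
    if "\<eta> \<in> I" for \<eta>
  proof -
    have le: "\<bar>m \<eta>\<bar> \<le> (\<Sum>\<xi>\<in>?S. pmf \<mu> \<xi> * \<bar>indicator_defect F \<xi> \<eta>\<bar>)"
      unfolding m_def by (rule order_trans[OF sum_abs]) (simp add: abs_mult)
    also have "\<dots> \<le> (\<Sum>\<xi>\<in>?S. pmf \<mu> \<xi> * 1)"
      using that F S by (intro sum_mono mult_left_mono abs_indicator_defect_le) auto
    finally have "\<bar>m \<eta>\<bar> \<le> 1" by (simp add: sum_pmf_supp)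
    \<comment> \<open>A number of modulus at most 1 has square at most its modulus: this is the
      passage from the 1-norm to the 2-norm.\<close>
    then have "\<bar>m \<eta>\<bar> * \<bar>m \<eta>\<bar> \<le> \<bar>m \<eta>\<bar> * 1" by (intro mult_left_mono) auto
    with le have "(m \<eta>)\<^sup>2 \<le> (\<Sum>\<xi>\<in>?S. pmf \<mu> \<xi> * \<bar>indicator_defect F \<xi> \<eta>\<bar>)"
      by (simp add: power2_eq_square abs_mult_self_eq)
    then have "(m \<eta>)\<^sup>2 * (d \<eta>)\<^sup>2 \<le> (\<Sum>\<xi>\<in>?S. pmf \<mu> \<xi> * \<bar>indicator_defect F \<xi> \<eta>\<bar>) * (d \<eta>)\<^sup>2"
      by (rule mult_right_mono) simp
    then show ?thesis by (simp add: sum_distrib_right mult.assoc)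
  qed
  have bound: "(\<Sum>\<eta>\<in>G. cmod (g \<eta>) ^ 2 * dim_measure d \<eta>) \<le> (sqrt X)\<^sup>2"
    if G: "finite G" "G \<subseteq> I" for G
  proof -
    have "(\<Sum>\<eta>\<in>G. cmod (g \<eta>) ^ 2 * dim_measure d \<eta>)
        = (\<Sum>\<eta>\<in>bar ` G. cmod (g (bar \<eta>)) ^ 2 * dim_measure d (bar \<eta>))"
      by (subst sum.reindex[OF inj_bar]) (simp add: bar_bar)
    also have "\<dots> = (\<Sum>\<eta>\<in>bar ` G. (m \<eta>)\<^sup>2 * (d \<eta>)\<^sup>2)"
      using G by (intro sum.cong refl) (auto simp: g_bar dim_measure_def dim_bar subset_iff)
    also have "\<dots> = (\<Sum>\<eta>\<in>bar ` G \<inter> ?B. (m \<eta>)\<^sup>2 * (d \<eta>)\<^sup>2)"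
    proof (intro sum.mono_neutral_right ballI)
      fix \<eta> assume "\<eta> \<in> bar ` G - bar ` G \<inter> ?B"
      then have "\<eta> \<in> I" "\<eta> \<notin> ?B" using G by auto
      then show "(m \<eta>)\<^sup>2 * (d \<eta>)\<^sup>2 = 0" by (simp add: m_0)
    qed (use G in auto)
    also have "\<dots> \<le> (\<Sum>\<eta>\<in>?B. (m \<eta>)\<^sup>2 * (d \<eta>)\<^sup>2)"
      using B by (intro sum_mono2) auto
    also have "\<dots> \<le> X" unfolding X_def using B m_sq by (intro sum_mono) auto
    also have "X = (sqrt X)\<^sup>2" by (simp add: X_def sum_nonneg)
    finally show ?thesis .
  qed
  have "0 \<le> sqrt X" by (simp add: X_def sum_nonneg)
  moreover have "g \<eta> = 0" if "\<eta> \<notin> I" for \<eta>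
    using that F by (auto simp: g_def markov_op_def indicator_def)
  ultimately have g: "g \<in> L2" "norm2 g \<le> sqrt X"
    using lp_space_2I[where f = g and C = "sqrt X", OF _ _ w_nonneg bound] by auto
  have "(norm2 g)\<^sup>2 \<le> (sqrt X)\<^sup>2" using g(2) norm2_nonneg by (intro power_mono)
  also have "\<dots> = X" by (simp add: X_def sum_nonneg)
  also have "X = (\<Sum>\<xi>\<in>?S. pmf \<mu> \<xi> * (\<Sum>\<eta>\<in>?B. \<bar>indicator_defect F \<xi> \<eta>\<bar> * (d \<eta>)\<^sup>2))"
    unfolding X_def by (subst sum.swap) (simp add: sum_distrib_left)
  also have "\<dots> < (\<Sum>\<xi>\<in>?S. pmf \<mu> \<xi> * (\<epsilon> * (\<Sum>\<eta>\<in>F. (d \<eta>)\<^sup>2)))"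
  proof (intro sum_strict_mono mult_strict_left_mono)
    fix \<xi> assume x: "\<xi> \<in> ?S"
    show "(\<Sum>\<eta>\<in>?B. \<bar>indicator_defect F \<xi> \<eta>\<bar> * (d \<eta>)\<^sup>2) < \<epsilon> * (\<Sum>\<eta>\<in>F. (d \<eta>)\<^sup>2)"
      using approx[OF x] unfolding lp_norm_1_right_op[OF F x S(3,1)] lp_norm_1_indicator[OF F] .
    show "0 < pmf \<mu> \<xi>" using x by (simp add: pmf_positive)
  qed (use S in auto)
  also have "\<dots> = \<epsilon> * (\<Sum>\<eta>\<in>F. (d \<eta>)\<^sup>2)"
    by (simp add: sum_distrib_right[symmetric] sum_pmf_supp)
  also have "(\<Sum>\<eta>\<in>F. (d \<eta>)\<^sup>2) = sum (dim_measure d) (bar ` F)"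
    using F by (subst sum.reindex[OF inj_bar]) (auto simp: dim_measure_def dim_bar intro!: sum.cong)
  finally show "\<exists>F. finite F \<and> F \<subseteq> I \<and>
      (\<lambda>\<eta>. markov_op (indicator F) \<eta> - indicator F \<eta>) \<in> L2 \<and>
      (norm2 (\<lambda>\<eta>. markov_op (indicator F) \<eta> - indicator F \<eta>))\<^sup>2 < \<epsilon> * sum (dim_measure d) F"
    using F g(1) by (intro exI[of _ "bar ` F"]) (auto simp: g_def)
qed

section \<open>Neighbourhoods and isoperimetry of the walk\<close>

definition nbhd_set :: "'r set \<Rightarrow> 'r set"
  where "nbhd_set F = (\<Union>\<alpha>\<in>F. \<Union>\<xi>\<in>set_pmf \<mu>. basis_supp I (\<alpha> * \<xi>))"

lemma finite_nbhd_set: "finite F \<Longrightarrow> finite (nbhd_set F)"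
  using finite_supp finite_basis_supp by (auto simp: nbhd_set_def)

lemma nbhd_set_subset: "nbhd_set F \<subseteq> I"
  by (auto simp: nbhd_set_def basis_supp_def)

text \<open>All terms of the convolution are nonnegative, so nothing cancels and its support is the
  union of the supports of the products.\<close>

lemma fun_supp_conv:
  assumes F: "finite F" "F \<subseteq> I"
  shows "fun_supp I (fusion_conv I d (indicator F) (pmf \<mu>)) = nbhd_set F"
proof -
  have eq: "fusion_conv I d (indicator F) (pmf \<mu>) \<alpha>
      = (\<Sum>(\<xi>, \<eta>)\<in>F \<times> set_pmf \<mu>. pmf \<mu> \<eta> * dc \<xi> \<eta> \<alpha>)" for \<alpha>
  proof -
    have "fusion_conv I d (indicator F) (pmf \<mu>) \<alpha>
        = (\<Sum>\<^sub>\<infinity>(\<xi>, \<eta>)\<in>F \<times> set_pmf \<mu>. pmf \<mu> \<eta> * dc \<xi> \<eta> \<alpha>)"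
      unfolding fusion_conv_def using F supp_subset
      by (intro infsum_cong_neutral) (auto simp: set_pmf_iff indicator_def)
    then show ?thesis using F finite_supp by simp
  qed
  have "fusion_conv I d (indicator F) (pmf \<mu>) \<alpha> = 0 \<longleftrightarrow>
      (\<forall>\<xi>\<in>F. \<forall>\<eta>\<in>set_pmf \<mu>. N \<xi> \<eta> \<alpha> = 0)" if a: "\<alpha> \<in> I" for \<alpha>
  proof -
    have "fusion_conv I d (indicator F) (pmf \<mu>) \<alpha> = 0 \<longleftrightarrow>
        (\<forall>x\<in>F \<times> set_pmf \<mu>. (case x of (\<xi>, \<eta>) \<Rightarrow> pmf \<mu> \<eta> * dc \<xi> \<eta> \<alpha>) = 0)"
      unfolding eq using a F finite_supp supp_subset dirac_conv_nonneg
      by (intro sum_nonneg_eq_0_iff) auto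
    also have "\<dots> \<longleftrightarrow> (\<forall>\<xi>\<in>F. \<forall>\<eta>\<in>set_pmf \<mu>. N \<xi> \<eta> \<alpha> = 0)"
      using a F supp_subset by (auto simp: set_pmf_iff dirac_conv_eq_0_iff subset_iff)
    finally show ?thesis .
  qed
  then show ?thesis by (auto simp: fun_supp_def nbhd_set_def basis_supp_mult)
qed

lemma subset_nbhd_set:
  assumes "1 \<in> set_pmf \<mu>" "F \<subseteq> I"
  shows "F \<subseteq> nbhd_set F"
proof
  fix \<alpha> assume "\<alpha> \<in> F"
  then have "\<alpha> \<in> basis_supp I (\<alpha> * 1)"
    using assms by (subst basis_supp_mult) (auto simp: fusion_coeff_one)
  with \<open>\<alpha> \<in> F\<close> assms show "\<alpha> \<in> nbhd_set F" unfolding nbhd_set_def by blast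
qed

text \<open>If every finite set expands by the factor \<open>1 + \<epsilon>\<close>, each point of
  the outer boundary still has transition probability at least \<open>c\<close> back into the set.
  The walk then has isoperimetric constant \<open>c * \<epsilon>\<close> and laziness
  \<open>pmf \<mu> 1\<close>, which excludes 1 from the spectrum.\<close>

lemma one_in_spectrum_imp_folner:
  assumes one: "1 \<in> set_pmf \<mu>" and eps: "0 < \<epsilon>"
    and spec: "1 \<in> lp_spectrum I (dim_measure d) 2 markov_op"
  shows "\<exists>F. finite F \<and> F \<subseteq> I \<and> (\<Sum>\<xi>\<in>nbhd_set F. (d \<xi>)\<^sup>2) < (1 + \<epsilon>) * (\<Sum>\<xi>\<in>F. (d \<xi>)\<^sup>2)"
proof (rule ccontr)
  assume "\<not> ?thesis"
  then have exp: "(1 + \<epsilon>) * (\<Sum>\<xi>\<in>F. (d \<xi>)\<^sup>2) \<le> (\<Sum>\<xi>\<in>nbhd_set F. (d \<xi>)\<^sup>2)"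
    if "finite F" "F \<subseteq> I" for F
    using that by (auto simp: not_less)
  \<comment> \<open>The least value over the finite support of the lower bound supplied by
    \<open>dirac_conv_ge\<close>.\<close>
  define c where "c = Min ((\<lambda>\<xi>. pmf \<mu> \<xi> / (d \<xi>)\<^sup>2) ` set_pmf \<mu>)"
  have "0 < pmf \<mu> \<xi> / (d \<xi>)\<^sup>2" if "\<xi> \<in> set_pmf \<mu>" for \<xi>
    using that d_pos[OF supp_subset[OF that]] by (intro divide_pos_pos pmf_positive) auto
  then have c_pos: "0 < c"
    unfolding c_def using finite_supp set_pmf_not_empty by (subst Min_gr_iff) auto
  have c_le: "c \<le> pmf \<mu> \<xi> / (d \<xi>)\<^sup>2" if "\<xi> \<in> set_pmf \<mu>" for \<xi>
    unfolding c_def using that finite_supp by (intro Min_le) auto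
  let ?w = "dim_measure d"
  have "1 \<notin> lp_spectrum I ?w 2 markov_op"
  proof (rule isoperimetric_imp_one_not_in_spectrum)
    show "0 < pmf \<mu> 1" using one by (simp add: pmf_positive)
    show "0 < c * \<epsilon>" using c_pos eps by simp
  next
    fix x assume x: "x \<in> I"
    have "1 \<le> dc 1 x x"
      using dirac_conv_ge[of 1 x x] x unit_in_basis by (simp add: fusion_coeff_one dim_one)
    then have "pmf \<mu> 1 * 1 \<le> pmf \<mu> 1 * dc 1 x x" by (intro mult_left_mono) auto
    also have "\<dots> \<le> walk x x" using walk_ge[OF one x x] .
    finally show "pmf \<mu> 1 \<le> walk x x" by simp
  next
    fix G assume G: "finite G" "G \<subseteq> I"
    \<comment> \<open>Neighbourhoods in (FC1) multiply on the right and the walk multiplies on the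
      left; reflecting by \<open>bar\<close> reconciles them without changing dimensions.\<close>
    define F where "F = bar ` G"
    have F: "finite F" "F \<subseteq> I" using G by (auto simp: F_def)
    have GF: "G = bar ` F" by (simp add: F_def image_image bar_bar)
    have wbar: "sum ?w (bar ` A) = (\<Sum>\<xi>\<in>A. (d \<xi>)\<^sup>2)" if "A \<subseteq> I" for A
      using that by (subst sum.reindex[OF inj_bar]) (auto simp: dim_measure_def dim_bar intro!: sum.cong)
    let ?O = "nbhd_set F - F"
    define B where "B = bar ` ?O"
    have B: "finite B" "B \<subseteq> I" "B \<inter> G = {}"
      using F finite_nbhd_set nbhd_set_subset[of F] by (auto simp: B_def GF)
    have B_walk: "\<exists>x\<in>G. c \<le> walk y x" if "y \<in> B" for y
    proof -
      from that obtain \<beta> \<alpha> \<xi> where y: "y = bar \<beta>" and b: "\<beta> \<in> I" "\<alpha> \<in> F" "\<xi> \<in> set_pmf \<mu>" "N \<alpha> \<xi> \<beta> \<noteq> 0"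
        by (auto simp: B_def nbhd_set_def basis_supp_mult)
      have xa: "\<xi> \<in> I" "\<alpha> \<in> I" "y \<in> I" using b supp_subset F y by auto
      \<comment> \<open>Reflection turns \<open>\<beta>\<close> in \<open>\<alpha> * \<xi>\<close>
        into \<open>y\<close> in \<open>bar \<xi> * bar \<alpha>\<close>, and Frobenius reciprocity
        turns this into a step of the walk from \<open>y\<close> to
        \<open>bar \<alpha>\<close>.\<close>
      have "N (bar \<xi>) (bar \<alpha>) y \<noteq> 0" using b xa by (simp add: y fusion_coeff_bar)
      then have n: "N \<xi> y (bar \<alpha>) \<noteq> 0" using frobenius_left[of \<xi> y "bar \<alpha>"] xa by simp
      have "c \<le> pmf \<mu> \<xi> * (1 / (d \<xi>)\<^sup>2)" using c_le[OF b(3)] by simp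
      also have "\<dots> \<le> pmf \<mu> \<xi> * dc \<xi> y (bar \<alpha>)"
        using xa n by (intro mult_left_mono dirac_conv_ge) auto
      also have "\<dots> \<le> walk y (bar \<alpha>)" using walk_ge[OF b(3)] xa by simp
      finally show ?thesis using b(2) GF by blast
    qed
    have "\<epsilon> * sum ?w G \<le> sum ?w B"
    proof -
      have "(\<Sum>\<xi>\<in>nbhd_set F. (d \<xi>)\<^sup>2) = (\<Sum>\<xi>\<in>?O. (d \<xi>)\<^sup>2) + (\<Sum>\<xi>\<in>F. (d \<xi>)\<^sup>2)"
        using F finite_nbhd_set subset_nbhd_set[OF one] by (intro sum.subset_diff) auto
      with exp[OF F] have "\<epsilon> * (\<Sum>\<xi>\<in>F. (d \<xi>)\<^sup>2) \<le> (\<Sum>\<xi>\<in>?O. (d \<xi>)\<^sup>2)"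
        by (simp add: algebra_simps)
      then show ?thesis using F nbhd_set_subset by (simp add: B_def GF wbar Diff_subset_conv le_supI2)
    qed
    then have "c * \<epsilon> * sum ?w G \<le> c * sum ?w B" using c_pos by simp
    also have "\<dots> \<le> (\<Sum>y\<in>B. ?w y * (\<Sum>x\<in>G. walk y x))"
      unfolding sum_distrib_left
    proof (rule sum_mono)
      fix y assume y: "y \<in> B"
      then obtain x where x: "x \<in> G" "c \<le> walk y x" using B_walk by blast
      note x(2)
      also have "walk y x \<le> (\<Sum>x\<in>G. walk y x)"
        using x(1) y G B by (intro member_le_sum) (auto intro!: p_nonneg)
      finally have "?w y * c \<le> ?w y * (\<Sum>x\<in>G. walk y x)"
        using y B w_nonneg by (intro mult_left_mono) auto
      then show "c * ?w y \<le> (\<Sum>x\<in>G. ?w y * walk y x)" by (simp add: sum_distrib_left mult.commute)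
    qed
    \<comment> \<open>The lower bound concerns the flow from \<open>B\<close> into \<open>G\<close>.
      Detailed balance makes it equal to the flow from \<open>G\<close> into \<open>B\<close>, which
      is part of what escapes from \<open>G\<close>.\<close>
    also have "\<dots> = (\<Sum>y\<in>B. \<Sum>x\<in>G. ?w x * walk x y)"
      unfolding sum_distrib_left using B G by (intro sum.cong refl reversible) auto
    also have "\<dots> = (\<Sum>x\<in>G. ?w x * (\<Sum>y\<in>B. walk x y))"
      unfolding sum_distrib_left by (rule sum.swap)
    also have "\<dots> \<le> (\<Sum>x\<in>G. ?w x * (1 - (\<Sum>y\<in>G. walk x y)))"
    proof (intro sum_mono mult_left_mono)
      fix x assume x: "x \<in> G"
      have "(\<Sum>y\<in>B. walk x y) + (\<Sum>y\<in>G. walk x y) = (\<Sum>y\<in>B \<union> G. walk x y)"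
        using B G by (intro sum.union_disjoint[symmetric]) auto
      also have "\<dots> \<le> 1" using B G x by (intro row_sum_finite_le) auto
      finally show "(\<Sum>y\<in>B. walk x y) \<le> 1 - (\<Sum>y\<in>G. walk x y)" by simp
    qed (use G w_nonneg in auto)
    finally show "c * \<epsilon> * sum ?w G \<le> (\<Sum>x\<in>G. ?w x * (1 - (\<Sum>y\<in>G. walk x y)))" .
  qed
  with spec show False by blast
qed

end

section \<open>The remaining implications and the equivalence\<close>

lemma sum_UN_le:
  fixes f :: "'a \<Rightarrow> real"
  assumes "finite A" "\<And>a. a \<in> A \<Longrightarrow> finite (B a)" "\<And>x. 0 \<le> f x"
  shows "sum f (\<Union>a\<in>A. B a) \<le> (\<Sum>a\<in>A. sum f (B a))"
  using assms(1,2)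
proof (induction A rule: finite_induct)
  case (insert a A)
  have "sum f (\<Union>a\<in>insert a A. B a) \<le> sum f (B a) + sum f (\<Union>a\<in>A. B a)"
    using insert.prems insert.hyps assms(3) sum.union_inter[of "B a" "\<Union>a\<in>A. B a" f]
      sum_nonneg[of "B a \<inter> (\<Union>a\<in>A. B a)" f] by simp
  with insert show ?case by simp
qed simp

context fusion_algebra
begin

text \<open>Every boundary point is reached from a point of \<open>nbhd_set F - F\<close> by
  multiplication with an element of \<open>T\<close>. The dimension bound for products then controls
  the whole boundary by the outer layer that (FC1) makes small.\<close>

lemma FC1_imp_FC3:
  assumes "folner_FC1 I bar d"
  shows "folner_FC3 I d"
  unfolding folner_FC3_def
proof (intro allI impI, elim conjE)
  fix S and \<epsilon> :: real assume S: "finite S" "S \<subseteq> I" and eps: "\<epsilon> > 0"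
  \<comment> \<open>Closing \<open>S\<close> under \<open>bar\<close> makes the uniform distribution
    on \<open>T\<close> symmetric, and adding 1 makes it admissible in (FC1).\<close>
  define T where "T = insert 1 (S \<union> bar ` S)"
  have T: "finite T" "T \<noteq> {}" "T \<subseteq> I" using S unit_in_basis by (auto simp: T_def)
  have bar_T: "bar \<xi> \<in> T \<longleftrightarrow> \<xi> \<in> T" for \<xi>
  proof -
    have "bar \<xi> \<in> bar ` A \<longleftrightarrow> \<xi> \<in> A" for A by (rule inj_image_mem_iff[OF inj_bar])
    moreover have "bar \<xi> \<in> A \<longleftrightarrow> \<xi> \<in> bar ` A" for A by (metis bar_bar image_iff)
    moreover have "bar \<xi> = 1 \<longleftrightarrow> \<xi> = 1" by (metis bar_bar bar_one)
    ultimately show ?thesis by (auto simp: T_def)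
  qed
  define \<mu> where "\<mu> = pmf_of_set T"
  have supp: "set_pmf \<mu> = T" using T by (simp add: \<mu>_def)
  interpret symmetric_walk I bar d \<mu>
  proof
    show "fin_symm_prob I bar \<mu>"
      using T by (simp add: fin_symm_prob_def supp) (simp add: \<mu>_def indicator_def bar_T)
  qed
  have one: "1 \<in> set_pmf \<mu>" by (simp add: supp T_def)
  \<comment> \<open>The factor lost in passing from the outer layer to its neighbours; (FC1) is
    therefore used with \<open>\<epsilon> / D\<close>.\<close>
  define D where "D = (\<Sum>\<xi>\<in>T. (d \<xi>)\<^sup>2)"
  have D: "0 < D"
    unfolding D_def using T d_pos by (intro sum_pos) force+
  then have "0 < \<epsilon> / D" using eps by simp
  with assms[unfolded folner_FC1_def, rule_format, of \<mu> "\<epsilon> / D"] symm one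
  obtain F where F: "finite F" "F \<subseteq> I"
    and folner: "(\<Sum>\<xi>\<in>nbhd_set F. (d \<xi>)\<^sup>2) < (1 + \<epsilon> / D) * (\<Sum>\<xi>\<in>F. (d \<xi>)\<^sup>2)"
    by (auto simp: fun_supp_conv)
  let ?O = "nbhd_set F - F"
  let ?N = "\<lambda>\<beta>. \<Union>\<xi>\<in>T. basis_supp I (\<beta> * \<xi>)"
  have O: "finite ?O" "?O \<subseteq> I" using F finite_nbhd_set nbhd_set_subset by auto
  have finN: "finite (?N \<beta>)" for \<beta> using T finite_basis_supp by auto
  \<comment> \<open>An inner boundary point \<open>\<alpha>\<close> returns from an outer neighbour
    \<open>\<beta>\<close> through \<open>bar \<xi>\<close>; an outer boundary point already lies in
    the layer and is reached from itself through 1.\<close>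
  have sub: "boundary I S F \<subseteq> (\<Union>\<beta>\<in>?O. ?N \<beta>)"
  proof
    fix \<alpha> assume "\<alpha> \<in> boundary I S F"
    then consider \<xi> where "\<alpha> \<in> F" "\<xi> \<in> S" "\<not> basis_supp I (\<alpha> * \<xi>) \<subseteq> F"
      | \<xi> where "\<alpha> \<in> I" "\<alpha> \<notin> F" "\<xi> \<in> S" "\<not> basis_supp I (\<alpha> * \<xi>) \<subseteq> I - F"
      by (auto simp: boundary_def)
    then show "\<alpha> \<in> (\<Union>\<beta>\<in>?O. ?N \<beta>)"
    proof cases
      case (1 \<xi>)
      then obtain \<beta> where b: "\<beta> \<in> basis_supp I (\<alpha> * \<xi>)" "\<beta> \<notin> F" by blast
      have xT: "\<xi> \<in> T" "bar \<xi> \<in> T" using 1 by (auto simp: T_def)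
      have "\<beta> \<in> ?O" using 1 b xT by (auto simp: nbhd_set_def supp)
      moreover have "\<alpha> \<in> basis_supp I (\<beta> * bar \<xi>)"
        using 1 b subsetD[OF F(2) 1(1)] subsetD[OF T(3) xT(1)] frobenius_right[of \<alpha> \<xi> \<beta>]
        by (simp add: basis_supp_mult)
      ultimately show ?thesis using xT by blast
    next
      case (2 \<xi>)
      then obtain \<beta> where "\<beta> \<in> F" "\<alpha> \<in> basis_supp I (\<beta> * bar \<xi>)"
        using S outer_boundary_neighbour[of \<alpha> \<xi> F] by blast
      then have "\<alpha> \<in> nbhd_set F" using 2 by (auto simp: nbhd_set_def supp T_def)
      moreover have "\<alpha> \<in> basis_supp I (\<alpha> * 1)"
        using 2 by (subst basis_supp_mult) (simp add: fusion_coeff_one)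
      moreover have "1 \<in> T" by (simp add: T_def)
      ultimately show ?thesis using 2 by blast
    qed
  qed
  have "(\<Sum>\<xi>\<in>boundary I S F. (d \<xi>)\<^sup>2) \<le> (\<Sum>\<xi>\<in>(\<Union>\<beta>\<in>?O. ?N \<beta>). (d \<xi>)\<^sup>2)"
    using O finN sub by (intro sum_mono2) auto
  also have "\<dots> \<le> (\<Sum>\<beta>\<in>?O. \<Sum>\<xi>\<in>?N \<beta>. (d \<xi>)\<^sup>2)"
    using O finN by (intro sum_UN_le) auto
  also have "\<dots> \<le> (\<Sum>\<beta>\<in>?O. \<Sum>\<xi>\<in>T. \<Sum>\<alpha>\<in>basis_supp I (\<beta> * \<xi>). (d \<alpha>)\<^sup>2)"
    using T finite_basis_supp by (intro sum_mono sum_UN_le) auto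
  also have "\<dots> \<le> (\<Sum>\<beta>\<in>?O. \<Sum>\<xi>\<in>T. (d \<beta>)\<^sup>2 * (d \<xi>)\<^sup>2)"
    using O T by (intro sum_mono dim_sq_basis_supp_le) auto
  also have "\<dots> = D * (\<Sum>\<beta>\<in>?O. (d \<beta>)\<^sup>2)"
    by (simp add: D_def sum_product mult.commute sum.swap[of _ ?O])
  finally have "(\<Sum>\<xi>\<in>boundary I S F. (d \<xi>)\<^sup>2) \<le> D * (\<Sum>\<beta>\<in>?O. (d \<beta>)\<^sup>2)" .
  also have "\<dots> < D * (\<epsilon> / D * (\<Sum>\<xi>\<in>F. (d \<xi>)\<^sup>2))"
  proof (rule mult_strict_left_mono)
    have "(\<Sum>\<xi>\<in>nbhd_set F. (d \<xi>)\<^sup>2) = (\<Sum>\<xi>\<in>?O. (d \<xi>)\<^sup>2) + (\<Sum>\<xi>\<in>F. (d \<xi>)\<^sup>2)"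
      using F finite_nbhd_set subset_nbhd_set[OF one] by (intro sum.subset_diff) auto
    with folner show "(\<Sum>\<beta>\<in>?O. (d \<beta>)\<^sup>2) < \<epsilon> / D * (\<Sum>\<xi>\<in>F. (d \<xi>)\<^sup>2)"
      by (simp add: algebra_simps)
  qed (use D in simp)
  also have "\<dots> = \<epsilon> * (\<Sum>\<xi>\<in>F. (d \<xi>)\<^sup>2)" using D by simp
  finally show "\<exists>F. finite F \<and> F \<subseteq> I \<and>
      (\<Sum>\<xi>\<in>boundary I S F. (d \<xi>)\<^sup>2) < \<epsilon> * (\<Sum>\<xi>\<in>F. (d \<xi>)\<^sup>2)"
    using F by blast
qed

lemma FC2_imp_amenable:
  assumes "folner_FC2 I d"
  shows "amenable I bar d"
  unfolding amenable_def
proof (intro allI impI)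
  fix \<mu> assume "fin_symm_prob I bar \<mu>"
  then interpret symmetric_walk I bar d \<mu> by unfold_locales
  show "1 \<in> lp_spectrum I (dim_measure d) 2 (left_op_measure I bar d (pmf \<mu>))"
    unfolding left_op_measure_eq using assms by (rule FC2_imp_one_in_spectrum)
qed

lemma amenable_imp_FC1:
  assumes "amenable I bar d"
  shows "folner_FC1 I bar d"
  unfolding folner_FC1_def
proof (intro allI impI, elim conjE)
  fix \<mu> and \<epsilon> :: real assume \<mu>: "fin_symm_prob I bar \<mu>" "1 \<in> set_pmf \<mu>" "\<epsilon> > 0"
  then interpret symmetric_walk I bar d \<mu> by unfold_locales
  have "1 \<in> lp_spectrum I (dim_measure d) 2 markov_op"
    using assms symm by (simp add: amenable_def flip: left_op_measure_eq)
  from one_in_spectrum_imp_folner[OF \<mu>(2,3) this]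
  obtain F where "finite F" "F \<subseteq> I" "(\<Sum>\<xi>\<in>nbhd_set F. (d \<xi>)\<^sup>2) < (1 + \<epsilon>) * (\<Sum>\<xi>\<in>F. (d \<xi>)\<^sup>2)"
    by blast
  then show "\<exists>F. finite F \<and> F \<subseteq> I \<and>
      (\<Sum>\<xi>\<in>fun_supp I (fusion_conv I d (indicator F) (pmf \<mu>)). (d \<xi>)\<^sup>2)
        < (1 + \<epsilon>) * (\<Sum>\<xi>\<in>F. (d \<xi>)\<^sup>2)"
    by (intro exI[of _ F]) (simp add: fun_supp_conv)
qed

end

theorem theorem3p3:
  fixes I :: "'r::ring_1 set" and bar :: "'r \<Rightarrow> 'r" and d :: "'r \<Rightarrow> real"
  assumes "fusion_algebra I bar d"
  shows "(amenable I bar d \<longleftrightarrow> folner_FC1 I bar d) \<and>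
    (amenable I bar d \<longleftrightarrow> folner_FC2 I d) \<and>
    (amenable I bar d \<longleftrightarrow> folner_FC3 I d)"
proof -
  interpret fusion_algebra I bar d by fact
  show ?thesis
    using amenable_imp_FC1 FC1_imp_FC3 FC3_imp_FC2 FC2_imp_amenable by blast
qed

end
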